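(* (1) $F_3[0,1]^2$ is a 1-prevalent subset of $(C[0,1]^2,d_\infty)$; (2) for every $\alpha\in[2,3)$ the set $F_\alpha[0,1]^2$ is a 1-prevalent subset of $(C_\alpha[0,1]^2,d_{\alpha,2})$.
   Context: For $d\in\{1,2\}$, $C[0,1]^d$ is the real vector space of continuous functions $f:[0,1]^d\to\mathbb{R}$, and $d_\infty$ is the metric given by the sup norm $\|\cdot\|_\infty$. The graph of $f$ is $G_f=\{(\mathbf{x},f(\mathbf{x})):\mathbf{x}\in[0,1]^d\}\subset\mathbb{R}^{d+1}$. For $f\in C[0,1]^2$ the horizon function $H(f)\in C[0,1]$ is $H(f)(x)=\sup_{y\in[0,1]}f(x,y)$. For a bounded set $F$ in Euclidean space, $\underline{\dim}_{\mathrm B}F$ and $\overline{\dim}_{\mathrm B}F$ are the lower and upper limits as $\delta\to0$ of $\log N_\delta(F)/(-\log\delta)$, where $N_\delta(F)$ is the number of cubes of a $\delta$-mesh which intersect $F$; if they agree the common value is $\dim_{\mathrm B}F$. For $\alpha\in[2,3]$ define $C_\alpha[0,1]^2=\{f\in C[0,1]^2:\overline{\dim}_{\mathrm B}G_f\le\alpha\}$ (so $C_3[0,1]^2=C[0,1]^2$) and $$F_\alpha[0,1]^2=\{f\in C_\alpha[0,1]^2:\dim_{\mathrm B}G_f=\alpha\text{ and }\alpha-1\le\underline{\dim}_{\mathrm B}G_{H(f)}\le\overline{\dim}_{\mathrm B}G_{H(f)}\le2\},$$ where "$\dim_{\mathrm B}G_f=\alpha$" means that the box dimension exists and equals $\alpha$.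 Metric $d_{\alpha,2}$: for $\delta>0$, $\Delta_\delta^2$ is the collection of squares $[n_1\delta,(n_1+1)\delta]\times[n_2\delta,(n_2+1)\delta]$ with integers $0\le n_i\le\lceil\delta^{-1}\rceil-1$. For $S\in\Delta_\delta^2$, $R_f(S)=\sup|f(x)-f(y)|$ over $x,y\in S\cap[0,1]^2$. For $\beta\ge2$ put $\|f\|_{\beta,2}=\|f\|_\infty+\sup_{0<\delta\le1}\delta^{\beta-1}\sum_{S\in\Delta_\delta^2}R_f(S)$. For $\alpha\in[2,3)$ and $f,g\in C_\alpha[0,1]^2$, $d_{\alpha,2}(f,g)=\sum_{k=1}^\infty\min\{2^{-k},\|f-g\|_{\alpha+\frac1k,2}\}$. With this metric $C_\alpha[0,1]^2$ is a completely metrizable topological vector space. Let $X$ be a completely metrizable topological vector space. A Borel set $F\subseteq X$ is $k$-prevalent if there is a $k$-dimensional subspace $P\subseteq X$ (a probe for $F$) such that $\mathcal{L}_P(X\setminus(F+x))=0$ for all $x\in X$, where $\mathcal{L}_P$ is $k$-dimensional Lebesgue measure on $P$ (via a linear identification $P\cong\mathbb{R}^k$), regarded as a measure on $X$ by $\mathcal{L}_P(A)=\mathcal{L}_P(A\cap P)$. *)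

theory Defs
  imports "HOL-Analysis.Analysis" "HOL-Library.Function_Algebras"
begin

section \<open>Prevalence\<close>

instantiation "fun" :: (type, real_vector) real_vector
begin

definition scaleR_fun :: "real \<Rightarrow> ('a \<Rightarrow> 'b) \<Rightarrow> 'a \<Rightarrow> 'b"
  where "scaleR_fun c f = (\<lambda>x. c *\<^sub>R f x)"

instance
  by standard (auto simp: scaleR_fun_def fun_eq_iff scaleR_add_right scaleR_add_left)

end

text \<open>
  Lebesgue null sets of the span of linearly independent \<open>p 0, \<dots>, p (k - 1)\<close>, which is identified
  with \<open>k\<close>-dimensional real space by means of this basis (another basis gives the same null sets).
  As \<open>A\<close> only enters through its intersection with the span, this also describes the null sets of
  the measure extended to the ambient space. Membership in \<open>null_sets\<close>, unlike \<open>emeasure \<dots> = 0\<close>,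
  includes measurability.
\<close>

definition lebesgue_null_on_span :: "nat \<Rightarrow> (nat \<Rightarrow> 'a::real_vector) \<Rightarrow> 'a set \<Rightarrow> bool"
  where "lebesgue_null_on_span k p A \<longleftrightarrow>
    {c \<in> {..<k} \<rightarrow>\<^sub>E UNIV. (\<Sum>i<k. c i *\<^sub>R p i) \<in> A}
      \<in> null_sets (completion (\<Pi>\<^sub>M i\<in>{..<k}. (lborel :: real measure)))"

text \<open>
  The topology \<open>T\<close> is meant to be that of a completely metrizable topological vector space whose
  underlying vector space is the subspace \<open>topspace T\<close> of the type \<open>'a\<close>.
\<close>

definition prevalent :: "nat \<Rightarrow> 'a::real_vector topology \<Rightarrow> 'a set \<Rightarrow> bool"
  where "prevalent k T F \<longleftrightarrow>
    F \<in> sigma_sets (topspace T) {U. openin T U} \<and>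
    (\<exists>p. inj_on p {..<k} \<and> independent (p ` {..<k}) \<and> span (p ` {..<k}) \<subseteq> topspace T \<and>
      (\<forall>x\<in>topspace T. lebesgue_null_on_span k p (topspace T - (\<lambda>f. f + x) ` F)))"


section \<open>Box dimensions\<close>

definition mesh :: "real \<Rightarrow> 'a::euclidean_space set set"
  where "mesh \<delta> =
    {{x. \<forall>b\<in>Basis. of_int (n b) * \<delta> \<le> x \<bullet> b \<and> x \<bullet> b \<le> (of_int (n b) + 1) * \<delta>} | n :: 'a \<Rightarrow> int. True}"

text \<open>Only meaningful for bounded \<open>F\<close>, as \<open>card\<close> is \<open>0\<close> on infinite sets.\<close>

definition mesh_count :: "real \<Rightarrow> 'a::euclidean_space set \<Rightarrow> nat"
  where "mesh_count \<delta> F = card {Q \<in> mesh \<delta>. Q \<inter> F \<noteq> {}}"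

definition lower_box_dim :: "'a::euclidean_space set \<Rightarrow> ereal"
  where "lower_box_dim F =
    Liminf (at_right 0) (\<lambda>\<delta>. ereal (ln (real (mesh_count \<delta> F)) / (- ln \<delta>)))"

definition upper_box_dim :: "'a::euclidean_space set \<Rightarrow> ereal"
  where "upper_box_dim F =
    Limsup (at_right 0) (\<lambda>\<delta>. ereal (ln (real (mesh_count \<delta> F)) / (- ln \<delta>)))"

definition has_box_dim :: "'a::euclidean_space set \<Rightarrow> real \<Rightarrow> bool"
  where "has_box_dim F s \<longleftrightarrow> lower_box_dim F = ereal s \<and> upper_box_dim F = ereal s"


section \<open>Continuous functions on the unit cube\<close>

text \<open>
  A function on the unit cube (the unit interval for \<open>'a = real\<close>, the unit square for
  \<open>'a = real \<times> real\<close>) is represented by its extension by \<open>0\<close>, so that equality of functions is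
  equality on the cube and the vector space operations are the pointwise ones.
\<close>

abbreviation unit_cube :: "'a::euclidean_space set"
  where "unit_cube \<equiv> cbox 0 One"

definition cont_fun :: "('a::euclidean_space \<Rightarrow> real) set"
  where "cont_fun = {f. continuous_on unit_cube f \<and> (\<forall>x. x \<notin> unit_cube \<longrightarrow> f x = 0)}"

definition graph :: "('a::euclidean_space \<Rightarrow> real) \<Rightarrow> ('a \<times> real) set"
  where "graph f = {(x, f x) | x. x \<in> unit_cube}"

definition horizon :: "(real \<times> real \<Rightarrow> real) \<Rightarrow> real \<Rightarrow> real"
  where "horizon f x = (if x \<in> {0..1} then SUP y\<in>{0..1}. f (x, y) else 0)"

definition C_alpha :: "real \<Rightarrow> (real \<times> real \<Rightarrow> real) set"
  where "C_alpha \<alpha> = {f \<in> cont_fun. upper_box_dim (graph f) \<le> ereal \<alpha>}"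

definition F_alpha :: "real \<Rightarrow> (real \<times> real \<Rightarrow> real) set"
  where "F_alpha \<alpha> = {f \<in> C_alpha \<alpha>. has_box_dim (graph f) \<alpha> \<and>
    ereal (\<alpha> - 1) \<le> lower_box_dim (graph (horizon f)) \<and>
    lower_box_dim (graph (horizon f)) \<le> upper_box_dim (graph (horizon f)) \<and>
    upper_box_dim (graph (horizon f)) \<le> 2}"


section \<open>The metrics\<close>

text \<open>
  Norms are taken in the extended nonnegative reals, since the suprema may be infinite for arbitrary
  functions; the distances are then nonnegative and symmetric on the whole function type, as
  \<^const>\<open>Metric_space\<close> requires.
\<close>

definition sup_norm :: "('a::euclidean_space \<Rightarrow> real) \<Rightarrow> ennreal"
  where "sup_norm f = (SUP x\<in>unit_cube. ennreal \<bar>f x\<bar>)"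

definition d_inf :: "('a::euclidean_space \<Rightarrow> real) \<Rightarrow> ('a \<Rightarrow> real) \<Rightarrow> real"
  where "d_inf f g = enn2real (sup_norm (f - g))"

definition squares :: "real \<Rightarrow> (real \<times> real) set set"
  where "squares \<delta> =
    {{of_int n1 * \<delta> .. (of_int n1 + 1) * \<delta>} \<times> {of_int n2 * \<delta> .. (of_int n2 + 1) * \<delta>} | n1 n2 :: int.
      0 \<le> n1 \<and> n1 \<le> \<lceil>1 / \<delta>\<rceil> - 1 \<and> 0 \<le> n2 \<and> n2 \<le> \<lceil>1 / \<delta>\<rceil> - 1}"

definition osc :: "(real \<times> real \<Rightarrow> real) \<Rightarrow> (real \<times> real) set \<Rightarrow> ennreal"
  where "osc f S = (SUP x\<in>S \<inter> unit_cube. SUP y\<in>S \<inter> unit_cube. ennreal \<bar>f x - f y\<bar>)"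

definition var_norm :: "real \<Rightarrow> (real \<times> real \<Rightarrow> real) \<Rightarrow> ennreal"
  where "var_norm \<beta> f =
    sup_norm f + (SUP \<delta>\<in>{0<..1}. ennreal (\<delta> powr (\<beta> - 1)) * (\<Sum>S\<in>squares \<delta>. osc f S))"

text \<open>The series runs over \<open>k \<ge> 1\<close>, whence \<open>Suc k\<close>.\<close>

definition d_alpha :: "real \<Rightarrow> (real \<times> real \<Rightarrow> real) \<Rightarrow> (real \<times> real \<Rightarrow> real) \<Rightarrow> real"
  where "d_alpha \<alpha> f g =
    (\<Sum>k. enn2real (min (ennreal (1 / 2 ^ Suc k)) (var_norm (\<alpha> + 1 / real (Suc k)) (f - g))))"

end

theory Submission
  imports Defs "HOL-Real_Asymp.Real_Asymp"
begin

text \<open>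
  At scale \<open>\<delta> = 2 ^ - n\<close> the number of mesh cubes meeting the graph of \<open>f\<close> on the \<open>d\<close>-dimensional unit
  cube is comparable to \<open>2 ^ (n * d) + 2 ^ n * V n f\<close>, where \<open>V n f\<close> is the sum of the oscillations of
  \<open>f\<close> over the dyadic cubes of level \<open>n\<close>. As \<open>V n\<close> is a seminorm, the parameters \<open>c\<close> with
  \<open>V n (c p + g) < V n p / (n + 1)\<^sup>2\<close> lie in an interval of length \<open>O(1 / n\<^sup>2)\<close>; by Borel--Cantelli,
  the lower box dimension of the graph of \<open>c p + g\<close> is at least that of \<open>p\<close> for almost every \<open>c\<close>.
  The probe is spanned by \<open>p (x, y) = \<phi> x\<close> with a Takagi type function \<open>\<phi>\<close> whose graph has
  box dimension \<open>\<alpha> - 1\<close>. Since \<open>p\<close> does not depend on \<open>y\<close>, the horizon of \<open>c p + g\<close> is \<open>c \<phi> + H(g)\<close>, and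
  the almost sure bound applies to the surface and to its horizon alike. Lower box dimension
  conditions are Borel because \<open>V n\<close> is continuous for the sup norm, hence also for the finer metrics.
\<close>

section \<open>Counting mesh cubes by oscillations\<close>

text \<open>Box dimension is a limit over all \<delta>, while mesh counts are not monotone in
  \<delta>; a two-sided comparison with a dyadic sequence, up to a constant, takes the place of
  monotonicity. Constants and polynomial factors in \<open>n\<close> disappear because dimension
  bounds are stated for every exponent strictly below or above the target. This freedom explains the
  two factors \<open>(n + 1)\<^sup>2\<close>: in the Borel--Cantelli step it makes the lengths of
  the exceptional intervals summable, and in the Takagi coefficients it makes the series converge
  when the exponential decay rate is 0, the case \<alpha> = 3. Both graphs must be controlled by one
  parameter. With decay rate 3 - \<alpha>, a function of \<open>x\<close> alone has graph dimension
  \<alpha> over the square and \<alpha> - 1 over the interval, so one probe reaches both targets.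
  Only lower bounds need an almost sure argument: the upper bound \<alpha> is part of membership in
  \<open>C_alpha\<close>, which is closed under linear combinations, and every continuous function
  on the interval has a graph of upper dimension at most 2.\<close>

definition grid_cube :: "real \<Rightarrow> ('a::euclidean_space \<Rightarrow> int) \<Rightarrow> 'a set"
  where "grid_cube \<delta> i = {x. \<forall>b\<in>Basis. of_int (i b) * \<delta> \<le> x \<bullet> b \<and> x \<bullet> b \<le> (of_int (i b) + 1) * \<delta>}"

text \<open>Extensional functions give each level \<open>n\<close> cube inside the unit cube exactly
  one index, so sums over indices are sums over cubes.\<close>

definition dyadic_index :: "nat \<Rightarrow> ('a::euclidean_space \<Rightarrow> int) set"
  where "dyadic_index n = Basis \<rightarrow>\<^sub>E {0..<2 ^ n}"

abbreviation dyadic_cube :: "nat \<Rightarrow> ('a::euclidean_space \<Rightarrow> int) \<Rightarrow> 'a set"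
  where "dyadic_cube n \<equiv> grid_cube (1 / 2 ^ n)"

definition total_osc :: "nat \<Rightarrow> ('a::euclidean_space \<Rightarrow> real) \<Rightarrow> real"
  where "total_osc n f = (\<Sum>i\<in>dyadic_index n. diameter (f ` dyadic_cube n i))"

text \<open>Each column over a dyadic cube contributes \<open>1 + 2 ^ n * diameter\<close>, roughly
  the number of cubes of side \<open>1 / 2 ^ n\<close> in a stack covering the graph there.\<close>

definition dyadic_count :: "nat \<Rightarrow> ('a::euclidean_space \<Rightarrow> real) \<Rightarrow> real"
  where "dyadic_count n f = 2 ^ (n * DIM('a)) + 2 ^ n * total_osc n f"

lemma mesh_eq_range: "mesh \<delta> = range (grid_cube \<delta>)"
  by (auto simp: mesh_def grid_cube_def)

lemma grid_cube_cong: "(\<And>b. b \<in> Basis \<Longrightarrow> i b = j b) \<Longrightarrow> grid_cube \<delta> i = grid_cube \<delta> j"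
  by (auto simp: grid_cube_def)

lemma grid_cube_eq_cbox:
  "grid_cube \<delta> i = cbox (\<Sum>b\<in>Basis. (of_int (i b) * \<delta>) *\<^sub>R b) (\<Sum>b\<in>Basis. ((of_int (i b) + 1) * \<delta>) *\<^sub>R b)"
  by (auto simp: grid_cube_def mem_box)

lemma grid_cube_corner:
  "\<delta> \<ge> 0 \<Longrightarrow> (\<Sum>b\<in>Basis. (of_int (i b) * \<delta>) *\<^sub>R b) \<in> grid_cube \<delta> i"
  by (simp add: grid_cube_def algebra_simps)

lemma grid_cube_subset_le:
  assumes "0 < \<delta>" "grid_cube \<delta> i \<subseteq> grid_cube \<delta> j" "b \<in> Basis"
  shows "j b \<le> i b"
proof -
  have "(\<Sum>b\<in>Basis. (of_int (i b) * \<delta>) *\<^sub>R b) \<in> grid_cube \<delta> j"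
    using grid_cube_corner[of \<delta> i] assms by auto
  then have "of_int (j b) * \<delta> \<le> of_int (i b) * \<delta>"
    using assms(3) by (simp add: grid_cube_def)
  then show ?thesis using assms(1) by simp
qed

lemma grid_cube_inject:
  assumes "0 < \<delta>" "grid_cube \<delta> i = grid_cube \<delta> j" "b \<in> Basis"
  shows "i b = j b"
  using grid_cube_subset_le[of \<delta> i j b] grid_cube_subset_le[of \<delta> j i b] assms by simp

lemma finite_dyadic_index [simp]: "finite (dyadic_index n)"
  by (simp add: dyadic_index_def finite_PiE)

lemma card_dyadic_index:
  "card (dyadic_index n :: ('a::euclidean_space \<Rightarrow> int) set) = 2 ^ (n * DIM('a))"
  by (simp add: dyadic_index_def card_PiE power_mult nat_power_eq)

lemma dyadic_cube_subset:
  assumes "i \<in> dyadic_index n"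
  shows "dyadic_cube n i \<subseteq> unit_cube"
proof
  fix x assume x: "x \<in> dyadic_cube n i"
  have "0 \<le> x \<bullet> b \<and> x \<bullet> b \<le> 1" if b: "b \<in> Basis" for b
  proof -
    have i: "0 \<le> i b" "i b + 1 \<le> 2 ^ n" using assms b by (auto simp: dyadic_index_def PiE_iff)
    have "real_of_int (i b + 1) \<le> real_of_int (2 ^ n)" using i(2) by (simp only: of_int_le_iff)
    then have i2: "(real_of_int (i b) + 1) * (1 / 2 ^ n) \<le> 1" by simp
    have "0 \<le> real_of_int (i b) * (1 / 2 ^ n)" using i(1) by simp
    moreover have "real_of_int (i b) * (1 / 2 ^ n) \<le> x \<bullet> b" "x \<bullet> b \<le> (real_of_int (i b) + 1) * (1 / 2 ^ n)"
      using x b by (auto simp: grid_cube_def)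
    ultimately show ?thesis using i2 by linarith
  qed
  then show "x \<in> unit_cube" by (simp add: mem_box)
qed

lemma unit_cube_covered:
  assumes "x \<in> unit_cube"
  shows "\<exists>i\<in>dyadic_index n. x \<in> dyadic_cube n i"
proof -
  \<comment> \<open>The cap \<open>2 ^ n - 1\<close> serves the faces
    \<open>x \<bullet> b = 1\<close>, where the floor \<open>2 ^ n\<close> would be out of
    range.\<close>
  define i where "i = (\<lambda>b\<in>Basis. min \<lfloor>2 ^ n * (x \<bullet> b)\<rfloor> (2 ^ n - 1))"
  have x: "0 \<le> x \<bullet> b" "x \<bullet> b \<le> 1" if "b \<in> Basis" for b
    using assms that by (auto simp: mem_box)
  have "i \<in> dyadic_index n"
    using x by (auto simp: i_def dyadic_index_def)
  moreover have "real_of_int (i b) * (1 / 2 ^ n) \<le> x \<bullet> b \<and> x \<bullet> b \<le> (real_of_int (i b) + 1) * (1 / 2 ^ n)"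
    if b: "b \<in> Basis" for b
  proof -
    have ib: "i b = min \<lfloor>2 ^ n * (x \<bullet> b)\<rfloor> (2 ^ n - 1)" using b by (simp add: i_def)
    have 1: "real_of_int (i b) \<le> 2 ^ n * (x \<bullet> b)"
      unfolding ib by linarith
    have "2 ^ n * (x \<bullet> b) \<le> 2 ^ n * 1" by (intro mult_left_mono x[OF b]) simp
    then have 2: "2 ^ n * (x \<bullet> b) \<le> real_of_int (i b) + 1"
      unfolding ib min_def by auto
    show ?thesis using 1 2 by (simp add: field_simps)
  qed
  ultimately show ?thesis by (auto simp: grid_cube_def)
qed

text \<open>An interval of length at most \<delta> meets at most three closed mesh intervals, hence
  the factor 3 per coordinate. The covering boxes are arbitrary: they may come from a dyadic stack
  or from another mesh, which yields comparisons in both directions.\<close>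

lemma mesh_cover:
  fixes F :: "'a::euclidean_space set"
  assumes I: "finite I" and \<delta>: "0 < \<delta>" "\<epsilon> \<le> \<delta>"
    and F: "\<And>x. x \<in> F \<Longrightarrow> \<exists>j\<in>I. \<forall>b\<in>Basis. a j \<bullet> b \<le> x \<bullet> b \<and> x \<bullet> b \<le> a j \<bullet> b + \<epsilon>"
  shows "finite {Q \<in> mesh \<delta>. Q \<inter> F \<noteq> {}}" "mesh_count \<delta> F \<le> 3 ^ DIM('a) * card I"
proof -
  define K where "K j = (\<Pi>\<^sub>E b\<in>Basis. {\<lceil>a j \<bullet> b / \<delta>\<rceil> - 1 .. \<lfloor>a j \<bullet> b / \<delta>\<rfloor> + 1})" for j
  note K = K_def
  have sub: "{Q \<in> mesh \<delta>. Q \<inter> F \<noteq> {}} \<subseteq> (\<Union>j\<in>I. grid_cube \<delta> ` K j)"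
  proof
    fix Q assume "Q \<in> {Q \<in> mesh \<delta>. Q \<inter> F \<noteq> {}}"
    then obtain i x where Q: "Q = grid_cube \<delta> i" and x: "x \<in> grid_cube \<delta> i" "x \<in> F"
      by (auto simp: mesh_eq_range)
    obtain j where j: "j \<in> I" "\<And>b. b \<in> Basis \<Longrightarrow> a j \<bullet> b \<le> x \<bullet> b \<and> x \<bullet> b \<le> a j \<bullet> b + \<epsilon>"
      using F[OF x(2)] by auto
    \<comment> \<open>A mesh index is arbitrary outside \<open>Basis\<close>; its restriction names
      the same cube and is extensional, as \<open>K j\<close> demands.\<close>
    have "restrict i Basis \<in> K j"
      unfolding K
    proof (rule restrict_PiE_iff[THEN iffD2], intro ballI)
      fix b :: 'a assume b: "b \<in> Basis"
      have "a j \<bullet> b \<le> (of_int (i b) + 1) * \<delta>" "of_int (i b) * \<delta> \<le> a j \<bullet> b + \<delta>"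
        using x(1) b j(2)[OF b] \<delta> by (force simp: grid_cube_def)+
      then have "a j \<bullet> b / \<delta> \<le> of_int (i b) + 1" "of_int (i b) \<le> a j \<bullet> b / \<delta> + 1"
        using \<delta> by (simp_all add: field_simps)
      then show "i b \<in> {\<lceil>a j \<bullet> b / \<delta>\<rceil> - 1 .. \<lfloor>a j \<bullet> b / \<delta>\<rfloor> + 1}"
        by (simp add: ceiling_le_iff le_floor_iff) linarith
    qed
    moreover have "Q = grid_cube \<delta> (restrict i Basis)"
      unfolding Q by (rule grid_cube_cong) simp
    ultimately show "Q \<in> (\<Union>j\<in>I. grid_cube \<delta> ` K j)" using j(1) by blast
  qed
  have fin: "finite (grid_cube \<delta> ` K j)" for j
    unfolding K by (intro finite_imageI finite_PiE) auto
  have cK: "card (grid_cube \<delta> ` K j) \<le> 3 ^ DIM('a)" for j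
  proof -
    have "card (grid_cube \<delta> ` K j) \<le> card (K j)"
      unfolding K by (intro card_image_le finite_PiE) auto
    also have "\<dots> = (\<Prod>b\<in>(Basis::'a set). card {\<lceil>a j \<bullet> b / \<delta>\<rceil> - 1 .. \<lfloor>a j \<bullet> b / \<delta>\<rfloor> + 1})"
      unfolding K by (intro card_PiE) simp
    also have "\<dots> \<le> (\<Prod>b\<in>(Basis::'a set). 3)"
    proof (rule prod_mono, intro conjI)
      fix b :: 'a
      have "\<lfloor>a j \<bullet> b / \<delta>\<rfloor> \<le> \<lceil>a j \<bullet> b / \<delta>\<rceil>" by (simp add: floor_le_ceiling)
      then show "card {\<lceil>a j \<bullet> b / \<delta>\<rceil> - 1 .. \<lfloor>a j \<bullet> b / \<delta>\<rfloor> + 1} \<le> 3"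
        by (simp add: nat_le_iff)
    qed simp
    finally show ?thesis by simp
  qed
  show f: "finite {Q \<in> mesh \<delta>. Q \<inter> F \<noteq> {}}"
    by (rule finite_subset[OF sub]) (use I fin in auto)
  have "mesh_count \<delta> F \<le> card (\<Union>j\<in>I. grid_cube \<delta> ` K j)"
    unfolding mesh_count_def by (rule card_mono[OF _ sub]) (use I fin in auto)
  also have "\<dots> \<le> (\<Sum>j\<in>I. card (grid_cube \<delta> ` K j))"
    by (rule card_UN_le[OF I])
  also have "\<dots> \<le> (\<Sum>j\<in>I. 3 ^ DIM('a))" by (rule sum_mono) (rule cK)
  finally show "mesh_count \<delta> F \<le> 3 ^ DIM('a) * card I" by (simp add: mult.commute)
qed

lemma ball_Basis_prod:
  "(\<forall>b\<in>Basis :: ('a::euclidean_space \<times> real) set. P b) \<longleftrightarrow> (\<forall>b\<in>Basis. P (b, 0)) \<and> P (0, 1)"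
  by (auto simp: Basis_prod_def)

text \<open>A box is compact and connected, so its continuous image is a compact interval: the
  diameter is the oscillation, and every intermediate value is attained, which the lower bound on
  mesh counts uses.\<close>

lemma image_dyadic_cube:
  assumes "f \<in> cont_fun" "i \<in> dyadic_index n"
  obtains m M where "f ` dyadic_cube n i = {m..M}" "m \<le> M" "diameter (f ` dyadic_cube n i) = M - m"
proof -
  have c: "continuous_on (dyadic_cube n i) f"
    using assms(1) continuous_on_subset[OF _ dyadic_cube_subset[OF assms(2)]] by (auto simp: cont_fun_def)
  have "compact (f ` dyadic_cube n i)" "connected (f ` dyadic_cube n i)"
    using c by (auto intro!: compact_continuous_image connected_continuous_image simp: grid_cube_eq_cbox
      convex_connected)
  then obtain m M where mM: "f ` dyadic_cube n i = {m..M}"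
    using connected_compact_interval_1 by metis
  moreover have "dyadic_cube n i \<noteq> {}" using grid_cube_corner[of "1/2^n" i] by auto
  ultimately have "m \<le> M" by (metis atLeastatMost_empty_iff image_is_empty)
  with mM that show ?thesis by (simp add: diameter_closed_interval)
qed

text \<open>Over each dyadic cube, cubes of side \<open>1 / 2 ^ n\<close> stacked upwards from the
  minimum cover the graph; \<open>mesh_cover\<close> passes to coarser meshes. Finiteness is
  recorded because \<open>mesh_count\<close> is a \<open>card\<close>, which is monotone only for
  finite sets.\<close>

lemma mesh_count_graph_le:
  fixes f :: "'a::euclidean_space \<Rightarrow> real"
  assumes f: "f \<in> cont_fun" and \<delta>: "1 / 2 ^ n \<le> \<delta>"
  shows "finite {Q \<in> mesh \<delta>. Q \<inter> graph f \<noteq> {}}"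
    "real (mesh_count \<delta> (graph f)) \<le> 3 ^ (DIM('a) + 1) * dyadic_count n f"
proof -
  have "\<exists>m M. f ` dyadic_cube n i = {m..M} \<and> m \<le> M \<and> diameter (f ` dyadic_cube n i) = M - m"
    if "i \<in> dyadic_index n" for i
    using image_dyadic_cube[OF f that] by metis
  then obtain m M where mM: "\<And>i. i \<in> dyadic_index n \<Longrightarrow>
      f ` dyadic_cube n i = {m i..M i} \<and> m i \<le> M i \<and> diameter (f ` dyadic_cube n i) = M i - m i"
    by metis
  define J where "J i = {0..nat \<lfloor>2 ^ n * (M i - m i)\<rfloor>}" for i
  define I where "I = Sigma (dyadic_index n :: ('a \<Rightarrow> int) set) J"
  define a where "a = (\<lambda>(i :: 'a \<Rightarrow> int, j :: nat). (\<Sum>b\<in>Basis. (of_int (i b) * (1 / 2 ^ n)) *\<^sub>R b, m i + real j / 2 ^ n))"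
  have I: "finite I" by (auto simp: I_def J_def)
  have \<delta>0: "0 < \<delta>" using \<delta> by (rule less_le_trans[rotated]) simp
  have cov: "\<exists>j\<in>I. \<forall>b\<in>Basis. a j \<bullet> b \<le> z \<bullet> b \<and> z \<bullet> b \<le> a j \<bullet> b + 1 / 2 ^ n"
    if "z \<in> graph f" for z
  proof -
    obtain x where z: "z = (x, f x)" and x: "x \<in> unit_cube" using \<open>z \<in> graph f\<close> by (auto simp: graph_def)
    obtain i where i: "i \<in> dyadic_index n" "x \<in> dyadic_cube n i" using unit_cube_covered[OF x] by auto
    have fx: "m i \<le> f x" "f x \<le> M i" using mM[OF i(1)] i(2) by auto
    define j where "j = nat \<lfloor>2 ^ n * (f x - m i)\<rfloor>"
    have "j \<in> J i" unfolding J_def j_def using fx by (auto intro!: nat_mono floor_mono)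
    then have "(i, j) \<in> I" using i by (auto simp: I_def)
    moreover have "real j = of_int \<lfloor>2 ^ n * (f x - m i)\<rfloor>" using fx by (simp add: j_def)
    then have "real j \<le> 2 ^ n * (f x - m i)" "2 ^ n * (f x - m i) \<le> real j + 1" by linarith+
    then have "m i + real j / 2 ^ n \<le> f x" "f x \<le> m i + real j / 2 ^ n + 1 / 2 ^ n"
      by (simp_all add: field_simps)
    moreover have "\<forall>b\<in>Basis. fst (a (i, j)) \<bullet> b \<le> x \<bullet> b \<and> x \<bullet> b \<le> fst (a (i, j)) \<bullet> b + 1 / 2 ^ n"
      using i(2) by (simp add: a_def grid_cube_def add_divide_distrib add.commute)
    ultimately have "(i, j) \<in> I \<and> (\<forall>b\<in>Basis. a (i, j) \<bullet> b \<le> z \<bullet> b \<and> z \<bullet> b \<le> a (i, j) \<bullet> b + 1 / 2 ^ n)"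
      unfolding ball_Basis_prod z by (simp add: a_def)
    then show ?thesis by blast
  qed
  show "finite {Q \<in> mesh \<delta>. Q \<inter> graph f \<noteq> {}}"
    by (rule mesh_cover(1)[OF I \<delta>0 \<delta> cov])
  have "mesh_count \<delta> (graph f) \<le> 3 ^ DIM('a \<times> real) * card I"
    by (rule mesh_cover(2)[OF I \<delta>0 \<delta> cov])
  then have "real (mesh_count \<delta> (graph f)) \<le> real (3 ^ DIM('a \<times> real) * card I)"
    by (simp only: of_nat_le_iff)
  moreover have "real (card I) \<le> dyadic_count n f"
  proof -
    have "real (card I) = (\<Sum>i\<in>dyadic_index n. 1 + of_int \<lfloor>2 ^ n * (M i - m i)\<rfloor>)"
    proof -
      have "real (card (J i)) = 1 + of_int \<lfloor>2 ^ n * (M i - m i)\<rfloor>" if "i \<in> dyadic_index n" for i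
        using mM[OF that] by (simp add: J_def)
      then show ?thesis unfolding I_def by (subst card_SigmaI) (simp_all add: J_def)
    qed
    also have "\<dots> \<le> (\<Sum>i\<in>dyadic_index n. 1 + 2 ^ n * diameter (f ` dyadic_cube n i))"
      proof (rule sum_mono)
      fix i :: "'a \<Rightarrow> int" assume "i \<in> dyadic_index n"
      from mM[OF this] show "1 + of_int \<lfloor>2 ^ n * (M i - m i)\<rfloor> \<le> 1 + 2 ^ n * diameter (f ` dyadic_cube n i)"
        by simp
    qed
    also have "\<dots> = dyadic_count n f"
      by (simp add: dyadic_count_def total_osc_def sum.distrib sum_distrib_left card_dyadic_index)
    finally show ?thesis .
  qed
  then have "real (3 ^ DIM('a \<times> real) * card I) \<le> 3 ^ (DIM('a) + 1) * dyadic_count n f"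
    by simp
  ultimately show "real (mesh_count \<delta> (graph f)) \<le> 3 ^ (DIM('a) + 1) * dyadic_count n f"
    by linarith
qed

text \<open>By the intermediate value property, every mesh cube of a column between the heights of
  minimum and maximum meets the graph. If there are \<open>k\<close> of them, then
  \<open>2 ^ n * (M - m) < k\<close> and \<open>1 \<le> k\<close>, so
  \<open>1 + 2 ^ n * (M - m) \<le> 2 * k\<close>; hence the factor 2.\<close>

lemma dyadic_count_le_mesh_count:
  fixes f :: "'a::euclidean_space \<Rightarrow> real"
  assumes f: "f \<in> cont_fun"
  shows "dyadic_count n f \<le> 2 * real (mesh_count (1 / 2 ^ n) (graph f))"
proof -
  have "\<exists>m M. f ` dyadic_cube n i = {m..M} \<and> m \<le> M \<and> diameter (f ` dyadic_cube n i) = M - m"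
    if "i \<in> dyadic_index n" for i
    using image_dyadic_cube[OF f that] by metis
  then obtain m M where mM: "\<And>i. i \<in> dyadic_index n \<Longrightarrow>
      f ` dyadic_cube n i = {m i..M i} \<and> m i \<le> M i \<and> diameter (f ` dyadic_cube n i) = M i - m i"
    by metis
  define \<delta> :: real where "\<delta> = 1 / 2 ^ n"
  have \<delta>: "0 < \<delta>" by (simp add: \<delta>_def)
  define J where "J i = {\<lfloor>2 ^ n * m i\<rfloor> .. \<lfloor>2 ^ n * M i\<rfloor>}" for i
  define I where "I = Sigma (dyadic_index n :: ('a \<Rightarrow> int) set) J"
  \<comment> \<open>Basis vectors of the product are \<open>(b, 0)\<close> and
    \<open>(0, 1)\<close>; the test \<open>v = 0\<close> tells which index applies.\<close>
  define q :: "('a \<Rightarrow> int) \<times> int \<Rightarrow> 'a \<times> real \<Rightarrow> int"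
    where "q = (\<lambda>(i, j) (u, v). if v = 0 then i u else j)"
  have q: "(x, y) \<in> grid_cube \<delta> (q (i, j)) \<longleftrightarrow>
      x \<in> grid_cube \<delta> i \<and> of_int j * \<delta> \<le> y \<and> y \<le> (of_int j + 1) * \<delta>" for x y i j
    unfolding grid_cube_def mem_Collect_eq ball_Basis_prod by (simp add: q_def)
  have inj: "inj_on (\<lambda>p. grid_cube \<delta> (q p)) I"
  proof (rule inj_onI)
    fix p p' assume p: "p \<in> I" "p' \<in> I" and eq: "grid_cube \<delta> (q p) = grid_cube \<delta> (q p')"
    obtain i j i' j' where ij: "p = (i, j)" "p' = (i', j')" by fastforce
    have *: "q p (b, 0) = q p' (b, 0)" if "b \<in> Basis" for b
      by (rule grid_cube_inject[OF \<delta> eq]) (use that in \<open>auto simp: Basis_prod_def\<close>)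
    have "q p (0, 1) = q p' (0, 1)"
      by (rule grid_cube_inject[OF \<delta> eq]) (auto simp: Basis_prod_def)
    then have "j = j'" by (simp add: ij q_def)
    moreover have "i = i'"
      by (rule PiE_ext[of i Basis "\<lambda>_. {0..<2^n}"]) (use p * in \<open>auto simp: ij I_def dyadic_index_def q_def\<close>)
    ultimately show "p = p'" by (simp add: ij)
  qed
  have sub: "(\<lambda>p. grid_cube \<delta> (q p)) ` I \<subseteq> {Q \<in> mesh \<delta>. Q \<inter> graph f \<noteq> {}}"
  proof clarsimp
    fix i j assume ij: "(i, j) \<in> I"
    then have i: "i \<in> dyadic_index n" and j: "\<lfloor>2 ^ n * m i\<rfloor> \<le> j" "j \<le> \<lfloor>2 ^ n * M i\<rfloor>"
      by (auto simp: I_def J_def)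
    have "of_int j \<le> 2 ^ n * M i" "2 ^ n * m i \<le> of_int j + 1" using j by linarith+
    then have j': "of_int j * \<delta> \<le> M i" "m i \<le> (of_int j + 1) * \<delta>"
      by (simp_all add: \<delta>_def field_simps)
    \<comment> \<open>Lowest common point of \<open>{m i..M i}\<close> and the mesh interval number
      \<open>j\<close>, which meet by the two bounds above.\<close>
    define y where "y = max (m i) (of_int j * \<delta>)"
    have "y \<in> {m i..M i}" using mM[OF i] j' by (auto simp: y_def)
    then obtain x where x: "x \<in> dyadic_cube n i" "y = f x" using mM[OF i] by (metis imageE)
    have "(x, y) \<in> grid_cube \<delta> (q (i, j))"
      unfolding q using x(1) j' \<delta> by (auto simp: y_def \<delta>_def divide_right_mono)
    moreover have "(x, y) \<in> graph f" using x dyadic_cube_subset[OF i] by (auto simp: graph_def)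
    ultimately show "grid_cube \<delta> (q (i, j)) \<in> mesh \<delta> \<and> grid_cube \<delta> (q (i, j)) \<inter> graph f \<noteq> {}"
      by (auto simp: mesh_eq_range)
  qed
  have "card I = card ((\<lambda>p. grid_cube \<delta> (q p)) ` I)" by (simp add: card_image[OF inj])
  also have "\<dots> \<le> mesh_count \<delta> (graph f)"
    unfolding mesh_count_def
    by (rule card_mono[OF mesh_count_graph_le(1)[OF f, of n] sub]) (simp add: \<delta>_def)
  finally have le: "card I \<le> mesh_count \<delta> (graph f)" .
  have "dyadic_count n f = (\<Sum>i\<in>dyadic_index n. 1 + 2 ^ n * diameter (f ` dyadic_cube n i))"
    by (simp add: dyadic_count_def total_osc_def sum.distrib sum_distrib_left card_dyadic_index)
  also have "\<dots> \<le> (\<Sum>i\<in>dyadic_index n. 2 * real (card (J i)))"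
  proof (rule sum_mono)
    fix i :: "'a \<Rightarrow> int" assume i: "i \<in> dyadic_index n"
    have "\<lfloor>2 ^ n * m i\<rfloor> \<le> \<lfloor>2 ^ n * M i\<rfloor>" using mM[OF i] by (intro floor_mono) simp
    then have "real (card (J i)) = of_int (\<lfloor>2 ^ n * M i\<rfloor> - \<lfloor>2 ^ n * m i\<rfloor> + 1)" "1 \<le> real (card (J i))"
      by (auto simp: J_def)
    then show "1 + 2 ^ n * diameter (f ` dyadic_cube n i) \<le> 2 * real (card (J i))"
      using mM[OF i] by (simp add: right_diff_distrib) linarith
  qed
  also have "\<dots> = 2 * real (card I)"
    unfolding I_def by (subst card_SigmaI) (auto simp: J_def sum_distrib_left)
  also have "\<dots> \<le> 2 * real (mesh_count \<delta> (graph f))" using le by simp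
  finally show ?thesis by (simp add: \<delta>_def)
qed

text \<open>The roles in \<open>mesh_cover\<close> are exchanged: the \<delta>-mesh cubes meeting
  the graph are the covering boxes, and the mesh of width \<open>1 / 2 ^ n\<close> is
  counted.\<close>

lemma dyadic_count_le_mesh_count_finer:
  fixes f :: "'a::euclidean_space \<Rightarrow> real"
  assumes f: "f \<in> cont_fun" and \<delta>: "0 < \<delta>" "\<delta> \<le> 1 / 2 ^ n"
  shows "dyadic_count n f \<le> 2 * 3 ^ (DIM('a) + 1) * real (mesh_count \<delta> (graph f))"
proof -
  let ?I = "{Q \<in> mesh \<delta>. Q \<inter> graph f \<noteq> {}}"
  \<comment> \<open>A dyadic scale below \<delta>, which supplies the finiteness of the family of
    \<delta>-mesh cubes.\<close>
  obtain k where "1 / \<delta> < real k" using reals_Archimedean2 by blast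
  moreover have "real k < 2 ^ k" by simp
  ultimately have "1 / \<delta> < 2 ^ k" by linarith
  then have k: "1 / 2 ^ k \<le> \<delta>" using \<delta> by (simp add: field_simps)
  \<comment> \<open>A mesh cube is a bare set; a chosen index provides its lower corner.\<close>
  define idx where "idx Q = (SOME i. Q = grid_cube \<delta> i)" for Q :: "('a \<times> real) set"
  define a where "a Q = (\<Sum>b\<in>Basis. (of_int (idx Q b) * \<delta>) *\<^sub>R b)" for Q :: "('a \<times> real) set"
  have cov: "\<exists>Q\<in>?I. \<forall>b\<in>Basis. a Q \<bullet> b \<le> z \<bullet> b \<and> z \<bullet> b \<le> a Q \<bullet> b + \<delta>" if z: "z \<in> graph f" for z
  proof -
    define i where "i b = \<lfloor>z \<bullet> b / \<delta>\<rfloor>" for b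
    have "of_int (i b) * \<delta> \<le> z \<bullet> b \<and> z \<bullet> b \<le> (of_int (i b) + 1) * \<delta>" for b
    proof -
      have "of_int (i b) \<le> z \<bullet> b / \<delta>" "z \<bullet> b / \<delta> \<le> of_int (i b) + 1"
        unfolding i_def by linarith+
      then show ?thesis using \<delta> by (simp add: pos_le_divide_eq pos_divide_le_eq)
    qed
    then have z': "z \<in> grid_cube \<delta> i" by (simp add: grid_cube_def)
    have Q: "grid_cube \<delta> i \<in> mesh \<delta>" by (simp add: mesh_eq_range)
    show ?thesis
    proof (rule bexI[of _ "grid_cube \<delta> i"])
      show "\<forall>b\<in>Basis. a (grid_cube \<delta> i) \<bullet> b \<le> z \<bullet> b \<and> z \<bullet> b \<le> a (grid_cube \<delta> i) \<bullet> b + \<delta>"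
        proof -
        have "grid_cube \<delta> i = grid_cube \<delta> (idx (grid_cube \<delta> i))"
          unfolding idx_def by (rule someI[where x = i and P = "\<lambda>j. grid_cube \<delta> i = grid_cube \<delta> j"]) (rule refl)
        then have "z \<in> grid_cube \<delta> (idx (grid_cube \<delta> i))" using z' by blast
        then show ?thesis by (simp add: a_def grid_cube_def[of _ "idx _"] distrib_right)
      qed
      show "grid_cube \<delta> i \<in> ?I" using z z' Q by blast
    qed
  qed
  have "mesh_count (1 / 2 ^ n) (graph f) \<le> 3 ^ DIM('a \<times> real) * card ?I"
    by (rule mesh_cover(2)[OF mesh_count_graph_le(1)[OF f k] _ \<delta>(2) cov]) simp
  then have "real (mesh_count (1 / 2 ^ n) (graph f)) \<le> real (3 ^ DIM('a \<times> real) * card ?I)"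
    by (simp only: of_nat_le_iff)
  then show ?thesis
    using dyadic_count_le_mesh_count[OF f, of n] by (simp add: mesh_count_def)
qed

section \<open>Box dimensions along dyadic scales\<close>

text \<open>A strict gap between exponents absorbs the quadratic factors that come from the Takagi
  coefficients and from Borel--Cantelli.\<close>

lemma eventually_powr_dominates:
  fixes C t u :: real
  assumes "t < u"
  shows "\<forall>\<^sub>F n in sequentially. C * (real n + 1)\<^sup>2 * 2 powr (real n * t) \<le> 2 powr (real n * u)"
proof -
  define e where "e = u - t"
  have e: "e > 0" using assms by (simp add: e_def)
  have "(\<lambda>n. C * (real n + 1)\<^sup>2 * 2 powr (- (real n * e))) \<longlonglongrightarrow> 0"
    using e by real_asymp
  then have "\<forall>\<^sub>F n in sequentially. C * (real n + 1)\<^sup>2 * 2 powr (- (real n * e)) < 1"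
    by (rule order_tendstoD) simp
  then show ?thesis
  proof eventually_elim
    case (elim n)
    have "C * (real n + 1)\<^sup>2 * 2 powr (real n * t) =
        (C * (real n + 1)\<^sup>2 * 2 powr (- (real n * e))) * 2 powr (real n * u)"
      by (simp add: e_def powr_add[symmetric] algebra_simps)
    also have "\<dots> \<le> 1 * 2 powr (real n * u)" using elim by (intro mult_right_mono) auto
    finally show ?case by simp
  qed
qed

lemma eventually_powr_dominates_const:
  fixes C t u :: real
  assumes "t < u"
  shows "\<forall>\<^sub>F n in sequentially. C * 2 powr (real n * t) \<le> 2 powr (real n * u)"
  using eventually_powr_dominates[OF assms, of "\<bar>C\<bar>"]
proof eventually_elim
  case (elim n)
  have "C * 1 \<le> \<bar>C\<bar> * (real n + 1)\<^sup>2"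
    by (intro mult_mono) (auto simp: power2_eq_square algebra_simps)
  then have "C * 2 powr (real n * t) \<le> \<bar>C\<bar> * (real n + 1)\<^sup>2 * 2 powr (real n * t)"
    by (intro mult_right_mono) auto
  with elim show ?case by linarith
qed

text \<open>\<open>n\<close> is the integer part of the binary logarithm of
  \<open>1 / \<delta>\<close>. The bounds on \<delta> serve to compare counts, the logarithmic ones
  to compare the denominators \<open>- ln \<delta>\<close>.\<close>

lemma dyadic_scale:
  fixes \<delta> :: real
  assumes "0 < \<delta>" "\<delta> \<le> 1 / 2 ^ n0"
  obtains n where "n0 \<le> n" "1 / 2 ^ Suc n \<le> \<delta>" "\<delta> \<le> 1 / 2 ^ n"
    "real n * ln 2 \<le> - ln \<delta>" "- ln \<delta> \<le> real (Suc n) * ln 2"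
proof -
  define n where "n = nat \<lfloor>- ln \<delta> / ln 2\<rfloor>"
  have "ln \<delta> \<le> ln (1 / 2 ^ n0)" using assms by (subst ln_le_cancel_iff) auto
  also have "\<dots> = - (real n0 * ln 2)" by (simp add: ln_div ln_realpow)
  finally have l0: "real n0 \<le> - ln \<delta> / ln 2" by (subst pos_le_divide_eq) auto
  then have n: "real n = of_int \<lfloor>- ln \<delta> / ln 2\<rfloor>" by (simp add: n_def)
  have "real n \<le> - ln \<delta> / ln 2" "- ln \<delta> / ln 2 \<le> real (Suc n)" unfolding n of_nat_Suc by linarith+
  then have 1: "real n * ln 2 \<le> - ln \<delta>" "- ln \<delta> \<le> real (Suc n) * ln 2"
    by (simp_all only: pos_le_divide_eq pos_divide_le_eq ln_gt_zero one_less_numeral_iff semiring_norm)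
  have p: "1 / 2 ^ k = exp (- (real k * ln 2))" for k
    by (simp add: exp_minus exp_of_nat_mult inverse_eq_divide)
  have "1 / 2 ^ Suc n \<le> exp (ln \<delta>)" "exp (ln \<delta>) \<le> 1 / 2 ^ n"
    unfolding p exp_le_cancel_iff using 1 by simp_all
  then have "1 / 2 ^ Suc n \<le> \<delta>" "\<delta> \<le> 1 / 2 ^ n" using assms by simp_all
  moreover have "n0 \<le> n" unfolding n_def using l0 by linarith
  ultimately show ?thesis using that 1 by blast
qed

lemma filterlim_dyadic_at_right: "filterlim (\<lambda>n. 1 / 2 ^ n :: real) (at_right 0) sequentially"
  by real_asymp

text \<open>\<open>NW\<close> and \<open>WN\<close> each cover all scales on one side of
  \<open>1 / 2 ^ n\<close>. They replace monotonicity of the mesh count, which fails because meshes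
  of different widths are not nested.\<close>

locale dyadic_comparison =
  fixes N :: "real \<Rightarrow> real" and W :: "nat \<Rightarrow> real" and C :: real
  assumes C: "0 < C" and W: "\<And>n. 1 \<le> W n"
    and NW: "\<And>n \<delta>. 1 / 2 ^ n \<le> \<delta> \<Longrightarrow> N \<delta> \<le> C * W n"
    and WN: "\<And>n \<delta>. 0 < \<delta> \<Longrightarrow> \<delta> \<le> 1 / 2 ^ n \<Longrightarrow> W n \<le> C * N \<delta>"
begin

lemma N_pos: "N (1 / 2 ^ n) > 0"
proof -
  have "0 < W n" using W[of n] by linarith
  also have "\<dots> \<le> C * N (1 / 2 ^ n)" by (rule WN) auto
  finally show ?thesis using C by (simp add: zero_less_mult_iff)
qed

text \<open>Forwards, restrict to dyadic \<delta>; backwards, compare \<delta> with its dyadic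
  neighbours. Positivity of \<open>s\<close> permits a positive \<open>t\<close>, so that
  multiplication by \<open>t\<close> preserves the upper bound on
  \<open>- ln \<delta>\<close>.\<close>

lemma le_Liminf_iff_dyadic:
  assumes s: "0 < s"
  shows "ereal s \<le> Liminf (at_right 0) (\<lambda>\<delta>. ereal (ln (N \<delta>) / (- ln \<delta>))) \<longleftrightarrow>
    (\<forall>t<s. \<forall>\<^sub>F n in sequentially. 2 powr (real n * t) \<le> W n)"
proof safe
  fix t :: real assume L: "ereal s \<le> Liminf (at_right 0) (\<lambda>\<delta>. ereal (ln (N \<delta>) / (- ln \<delta>)))" and t: "t < s"
  obtain u where u: "t < u" "u < s" using dense t by blast
  have "\<forall>\<^sub>F \<delta> in at_right 0. ereal u < ereal (ln (N \<delta>) / (- ln \<delta>))"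
    by (rule L[unfolded le_Liminf_iff, rule_format]) (simp add: u)
  then have "\<forall>\<^sub>F n in sequentially. ereal u < ereal (ln (N (1 / 2 ^ n)) / (- ln (1 / 2 ^ n)))"
    using filterlim_dyadic_at_right by (rule eventually_compose_filterlim)
  then show "\<forall>\<^sub>F n in sequentially. 2 powr (real n * t) \<le> W n"
    using eventually_gt_at_top[of 0] eventually_powr_dominates_const[OF u(1), of C]
  proof eventually_elim
    case (elim n)
    have "u * (real n * ln 2) < ln (N (1 / 2 ^ n))"
      using elim by (simp add: ln_div ln_realpow pos_less_divide_eq)
    then have "exp (u * (real n * ln 2)) < N (1 / 2 ^ n)"
      using N_pos[of n] by (metis exp_less_cancel_iff exp_ln)
    then have "2 powr (real n * u) < N (1 / 2 ^ n)" by (simp add: powr_def mult_ac)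
    also have "\<dots> \<le> C * W n" by (rule NW) simp
    finally have "C * 2 powr (real n * t) \<le> C * W n" using elim by linarith
    then show ?case using C by simp
  qed
next
  assume R: "\<forall>t<s. \<forall>\<^sub>F n in sequentially. 2 powr (real n * t) \<le> W n"
  show "ereal s \<le> Liminf (at_right 0) (\<lambda>\<delta>. ereal (ln (N \<delta>) / (- ln \<delta>)))"
    unfolding le_Liminf_iff
  proof (intro allI impI)
    fix y assume "y < ereal s"
    then obtain t where t: "y < ereal t" "0 < t" "t < s"
    proof -
      assume *: "\<And>t. y < ereal t \<Longrightarrow> 0 < t \<Longrightarrow> t < s \<Longrightarrow> thesis"
      have "max y 0 < ereal s" using \<open>y < ereal s\<close> s by simp
      then obtain z where "max y 0 < z" "z < ereal s" using dense by blast
      then show thesis using *[of "real_of_ereal z"] by (cases z) auto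
    qed
    obtain u where u: "t < u" "u < s" using dense t by blast
    \<comment> \<open>\<open>C\<close> is lost in \<open>WN\<close>, \<open>2 powr t\<close> in
      passing from \<open>n\<close> to \<open>Suc n\<close>, and 2 makes the final inequality
      strict.\<close>
    have "\<forall>\<^sub>F n in sequentially. 2 powr (real n * u) \<le> W n \<and> (2 * C * 2 powr t) * 2 powr (real n * t) \<le> 2 powr (real n * u)"
      using R u eventually_powr_dominates_const[OF u(1), of "2 * C * 2 powr t"] by (auto intro: eventually_conj)
    then obtain n0 where n0: "\<And>n. n \<ge> n0 \<Longrightarrow> 2 powr (real n * u) \<le> W n"
        "\<And>n. n \<ge> n0 \<Longrightarrow> (2 * C * 2 powr t) * 2 powr (real n * t) \<le> 2 powr (real n * u)"
      unfolding eventually_sequentially by blast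
    have "y < ereal (ln (N \<delta>) / (- ln \<delta>))" if \<delta>: "0 < \<delta>" "\<delta> < 1 / 2 ^ Suc n0" for \<delta>
    proof -
      have "\<delta> \<le> 1 / 2 ^ Suc n0" using \<delta> by simp
      from dyadic_scale[OF \<delta>(1) this]
      obtain n where n: "Suc n0 \<le> n" "1 / 2 ^ Suc n \<le> \<delta>" "\<delta> \<le> 1 / 2 ^ n"
        "real n * ln 2 \<le> - ln \<delta>" "- ln \<delta> \<le> real (Suc n) * ln 2" by metis
      have l0: "- ln \<delta> > 0" using n(1,4) by (intro less_le_trans[OF _ n(4)]) simp
      have "2 * C * 2 powr (real (Suc n) * t) = (2 * C * 2 powr t) * 2 powr (real n * t)"
        by (simp add: powr_add algebra_simps)
      also have "\<dots> \<le> W n" using n0[of n] n(1) by simp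
      also have "\<dots> \<le> C * N \<delta>" using WN \<delta> n by simp
      finally have "C * (2 * 2 powr (real (Suc n) * t)) \<le> C * N \<delta>" by (simp only: mult_ac)
      then have "2 * 2 powr (real (Suc n) * t) \<le> N \<delta>" using C by simp
      moreover have "0 < 2 powr (real (Suc n) * t)" by simp
      ultimately have *: "2 powr (real (Suc n) * t) < N \<delta>" by linarith
      have "t * (- ln \<delta>) \<le> t * (real (Suc n) * ln 2)" using n t by (intro mult_left_mono) auto
      also have "\<dots> = ln (2 powr (real (Suc n) * t))" by (simp add: ln_powr)
      also have "\<dots> < ln (N \<delta>)" using * by (intro ln_less_cancel_iff[THEN iffD2]) (auto intro: less_trans[OF _ *])
      finally have "t < ln (N \<delta>) / (- ln \<delta>)" using l0 by (simp only: pos_less_divide_eq)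
      then show ?thesis using t(1) by (meson ereal_less_eq(3) less_le_trans less_imp_le)
    qed
    then show "\<forall>\<^sub>F \<delta> in at_right 0. y < ereal (ln (N \<delta>) / (- ln \<delta>))"
      unfolding eventually_at_right_field by (intro exI[of _ "1 / 2 ^ Suc n0"]) auto
  qed
qed

lemma Limsup_le_iff_dyadic:
  assumes s: "0 \<le> s"
  shows "Limsup (at_right 0) (\<lambda>\<delta>. ereal (ln (N \<delta>) / (- ln \<delta>))) \<le> ereal s \<longleftrightarrow>
    (\<forall>t>s. \<forall>\<^sub>F n in sequentially. W n \<le> 2 powr (real n * t))"
proof safe
  fix t :: real assume L: "Limsup (at_right 0) (\<lambda>\<delta>. ereal (ln (N \<delta>) / (- ln \<delta>))) \<le> ereal s" and t: "s < t"
  obtain u where u: "s < u" "u < t" using dense t by blast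
  have "\<forall>\<^sub>F \<delta> in at_right 0. ereal u > ereal (ln (N \<delta>) / (- ln \<delta>))"
    by (rule L[unfolded Limsup_le_iff, rule_format]) (simp add: u)
  then have "\<forall>\<^sub>F n in sequentially. ereal u > ereal (ln (N (1 / 2 ^ n)) / (- ln (1 / 2 ^ n)))"
    using filterlim_dyadic_at_right by (rule eventually_compose_filterlim)
  then show "\<forall>\<^sub>F n in sequentially. W n \<le> 2 powr (real n * t)"
    using eventually_gt_at_top[of 0] eventually_powr_dominates_const[OF u(2), of C]
  proof eventually_elim
    case (elim n)
    have "ln (N (1 / 2 ^ n)) < u * (real n * ln 2)"
      using elim by (simp add: ln_div ln_realpow pos_divide_less_eq)
    then have "N (1 / 2 ^ n) < exp (u * (real n * ln 2))"
      using N_pos[of n] by (metis exp_less_cancel_iff exp_ln)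
    then have "N (1 / 2 ^ n) \<le> 2 powr (real n * u)" by (simp add: powr_def mult_ac)
    then have "C * N (1 / 2 ^ n) \<le> C * 2 powr (real n * u)" using C by simp
    moreover have "W n \<le> C * N (1 / 2 ^ n)" by (rule WN) auto
    ultimately show ?case using elim by linarith
  qed
next
  assume R: "\<forall>t>s. \<forall>\<^sub>F n in sequentially. W n \<le> 2 powr (real n * t)"
  show "Limsup (at_right 0) (\<lambda>\<delta>. ereal (ln (N \<delta>) / (- ln \<delta>))) \<le> ereal s"
    unfolding Limsup_le_iff
  proof (intro allI impI)
    fix y assume "ereal s < y"
    then obtain t where t: "ereal t < y" "s < t"
    proof -
      assume *: "\<And>t. ereal t < y \<Longrightarrow> s < t \<Longrightarrow> thesis"
      obtain z where "ereal s < z" "z < y" using dense \<open>ereal s < y\<close> by blast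
      then show thesis using *[of "real_of_ereal z"] by (cases z) auto
    qed
    obtain u where u: "s < u" "u < t" using dense t by blast
    \<comment> \<open>\<open>C\<close> is lost in \<open>NW\<close>, \<open>2 powr t\<close> shifts
      the exponent from \<open>Suc n\<close> back to \<open>n\<close>, and 2 again gives
      strictness.\<close>
    have "\<forall>\<^sub>F n in sequentially. W n \<le> 2 powr (real n * u) \<and> (2 * C * 2 powr t) * 2 powr (real n * u) \<le> 2 powr (real n * t)"
      using R u eventually_powr_dominates_const[OF u(2), of "2 * C * 2 powr t"] by (auto intro: eventually_conj)
    then obtain n0 where n0: "\<And>n. n \<ge> n0 \<Longrightarrow> W n \<le> 2 powr (real n * u)"
        "\<And>n. n \<ge> n0 \<Longrightarrow> (2 * C * 2 powr t) * 2 powr (real n * u) \<le> 2 powr (real n * t)"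
      unfolding eventually_sequentially by blast
    have "ereal (ln (N \<delta>) / (- ln \<delta>)) < y" if \<delta>: "0 < \<delta>" "\<delta> < 1 / 2 ^ Suc n0" for \<delta>
    proof -
      have "\<delta> \<le> 1 / 2 ^ Suc n0" using \<delta> by simp
      from dyadic_scale[OF \<delta>(1) this]
      obtain n where n: "Suc n0 \<le> n" "1 / 2 ^ Suc n \<le> \<delta>" "\<delta> \<le> 1 / 2 ^ n"
        "real n * ln 2 \<le> - ln \<delta>" "- ln \<delta> \<le> real (Suc n) * ln 2" by metis
      have l0: "- ln \<delta> > 0" using n(1,4) by (intro less_le_trans[OF _ n(4)]) simp
      have "0 < W n" using W[of n] by linarith
      also have "W n \<le> C * N \<delta>" using WN \<delta> n by simp
      finally have Np: "0 < N \<delta>" using C by (simp add: zero_less_mult_iff)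
      have "N \<delta> \<le> C * W (Suc n)" using NW n by simp
      also have "\<dots> \<le> C * 2 powr (real (Suc n) * u)" using n0(1)[of "Suc n"] n C by simp
      finally have "2 * 2 powr t * N \<delta> \<le> 2 * 2 powr t * (C * 2 powr (real (Suc n) * u))"
        by simp
      also have "\<dots> = (2 * C * 2 powr t) * 2 powr (real (Suc n) * u)" by simp
      also have "\<dots> \<le> 2 powr (real (Suc n) * t)" using n0(2)[of "Suc n"] n by simp
      also have "\<dots> = 2 powr t * 2 powr (real n * t)" by (simp add: powr_add algebra_simps)
      finally have "2 * N \<delta> \<le> 2 powr (real n * t)" by simp
      then have "N \<delta> < 2 powr (real n * t)" using Np by linarith
      then have "ln (N \<delta>) < ln (2 powr (real n * t))" using Np by (subst ln_less_cancel_iff) auto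
      also have "\<dots> = t * (real n * ln 2)" by (simp add: ln_powr)
      also have "\<dots> \<le> t * (- ln \<delta>)" using n t s by (intro mult_left_mono) auto
      finally have "ln (N \<delta>) / (- ln \<delta>) < t" using l0 by (simp only: pos_divide_less_eq)
      then show ?thesis using t(1) by (meson ereal_less_eq(3) le_less_trans less_imp_le)
    qed
    then show "\<forall>\<^sub>F \<delta> in at_right 0. ereal (ln (N \<delta>) / (- ln \<delta>)) < y"
      unfolding eventually_at_right_field by (intro exI[of _ "1 / 2 ^ Suc n0"]) auto
  qed
qed

end

lemma diameter_image_nonneg:
  assumes "f \<in> cont_fun" "i \<in> dyadic_index n"
  shows "0 \<le> diameter (f ` dyadic_cube n i)"
  using image_dyadic_cube[OF assms] by (metis diff_ge_0_iff_ge)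

lemma total_osc_nonneg: "f \<in> cont_fun \<Longrightarrow> 0 \<le> total_osc n f"
  unfolding total_osc_def by (intro sum_nonneg diameter_image_nonneg)

lemma dyadic_count_ge:
  fixes f :: "'a::euclidean_space \<Rightarrow> real"
  shows "f \<in> cont_fun \<Longrightarrow> 2 ^ (n * DIM('a)) \<le> dyadic_count n f"
  by (simp add: dyadic_count_def total_osc_nonneg)

lemma dyadic_count_ge_1: "f \<in> cont_fun \<Longrightarrow> 1 \<le> dyadic_count n f"
  by (rule order_trans[OF _ dyadic_count_ge]) auto

lemma graph_dyadic_comparison:
  fixes f :: "'a::euclidean_space \<Rightarrow> real"
  assumes f: "f \<in> cont_fun"
  shows "dyadic_comparison (\<lambda>\<delta>. real (mesh_count \<delta> (graph f))) (\<lambda>n. dyadic_count n f) (2 * 3 ^ (DIM('a) + 1))"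
proof
  fix n and \<delta> :: real
  show "1 / 2 ^ n \<le> \<delta> \<Longrightarrow> real (mesh_count \<delta> (graph f)) \<le> 2 * 3 ^ (DIM('a) + 1) * dyadic_count n f"
    using mesh_count_graph_le(2)[OF f, of n \<delta>] dyadic_count_ge_1[OF f, of n]
    by (smt (verit) mult_nonneg_nonneg zero_le_power mult_2 distrib_right)
qed (use dyadic_count_ge_1[OF f] dyadic_count_le_mesh_count_finer[OF f] in auto)

text \<open>With this and its upper counterpart, dimensions of graphs are from here on handled
  through the sequence \<open>dyadic_count n f\<close>.\<close>

lemma le_lower_box_dim_graph_iff:
  assumes "f \<in> cont_fun" "0 < s"
  shows "ereal s \<le> lower_box_dim (graph f) \<longleftrightarrow>
    (\<forall>t<s. \<forall>\<^sub>F n in sequentially. 2 powr (real n * t) \<le> dyadic_count n f)"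
  unfolding lower_box_dim_def
  by (rule dyadic_comparison.le_Liminf_iff_dyadic[OF graph_dyadic_comparison]) (use assms in auto)

lemma upper_box_dim_graph_le_iff:
  assumes "f \<in> cont_fun" "0 \<le> s"
  shows "upper_box_dim (graph f) \<le> ereal s \<longleftrightarrow>
    (\<forall>t>s. \<forall>\<^sub>F n in sequentially. dyadic_count n f \<le> 2 powr (real n * t))"
  unfolding upper_box_dim_def
  by (rule dyadic_comparison.Limsup_le_iff_dyadic[OF graph_dyadic_comparison]) (use assms in auto)

lemma lower_le_upper_box_dim: "lower_box_dim F \<le> upper_box_dim F"
  unfolding lower_box_dim_def upper_box_dim_def by (rule Liminf_le_Limsup) simp

section \<open>A Takagi function of prescribed dimension\<close>

text \<open>Distance to the nearest integer, the wave underlying the Takagi function.\<close>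

definition tri :: "real \<Rightarrow> real"
  where "tri x = \<bar>x - of_int (round x)\<bar>"

lemma tri_nonneg: "0 \<le> tri x"
  by (simp add: tri_def)

lemma tri_le_half: "tri x \<le> 1 / 2"
  unfolding tri_def using of_int_round_abs_le[of x] by (simp add: abs_minus_commute)

lemma tri_le: "tri x \<le> \<bar>x - of_int m\<bar>"
  unfolding tri_def by (rule round_diff_minimal)

lemma tri_lipschitz: "\<bar>tri x - tri y\<bar> \<le> \<bar>x - y\<bar>"
  using tri_le[of x "round y"] tri_le[of y "round x"] unfolding tri_def by linarith

lemma tri_diff_le_1: "\<bar>tri x - tri y\<bar> \<le> 1"
  using tri_nonneg[of x] tri_nonneg[of y] tri_le_half[of x] tri_le_half[of y] by linarith

text \<open>At half-integers \<open>round\<close> selects one of two nearest integers; either gives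
  the value, so piecewise formulas hold on closed intervals.\<close>

lemma tri_eq:
  assumes "\<bar>x - of_int q\<bar> \<le> 1 / 2"
  shows "tri x = \<bar>x - of_int q\<bar>"
proof (cases "round x = q")
  case False
  then have "1 \<le> \<bar>round x - q\<bar>" by linarith
  then have "1 \<le> \<bar>of_int (round x - q) :: real\<bar>" by (metis of_int_1_le_iff of_int_abs)
  then have "\<bar>x - of_int q\<bar> \<le> tri x" using assms unfolding tri_def of_int_diff by linarith
  with tri_le[of x q] show ?thesis by simp
qed (simp add: tri_def)

lemma tri_of_int [simp]: "tri (of_int m) = 0"
  using tri_eq[of "of_int m" m] by simp

lemma tri_affine:
  assumes "of_int m / 2 \<le> x" "x \<le> (of_int m + 1) / 2"
  shows "tri x = (if even m then x - of_int m / 2 else (of_int m + 1) / 2 - x)"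
proof (cases "even m")
  case True
  then obtain q where "m = 2 * q" by blast
  then show ?thesis using assms tri_eq[of x q] by simp
next
  case False
  then obtain q where m: "m = 2 * q + 1" using oddE by blast
  then have "\<bar>x - of_int (q + 1)\<bar> \<le> 1 / 2" "x \<le> of_int (q + 1)" using assms by auto
  then show ?thesis using tri_eq[of x "q + 1"] False m by simp
qed

text \<open>
  At the midpoint of a dyadic interval of level \<open>n\<close> only the \<open>n\<close>-th term of the Takagi series has a
  nonzero second difference, which bounds the oscillation on that interval from below.
\<close>

lemma tri_second_difference:
  fixes j :: int
  shows "tri (2 ^ k * ((2 * of_int j + 1) / 2 ^ Suc n)) -
      (tri (2 ^ k * (of_int j / 2 ^ n)) + tri (2 ^ k * ((of_int j + 1) / 2 ^ n))) / 2 =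
    (if k = n then 1 / 2 else 0)"
proof -
  consider "k = n" | "n < k" | "k < n" by linarith
  then show ?thesis
  proof cases
    case 1
    have "tri (of_int j + 1 / 2) = 1 / 2" using tri_eq[of "of_int j + 1 / 2" j] by simp
    moreover have "2 ^ n * ((2 * real_of_int j + 1) / 2 ^ Suc n) = of_int j + 1 / 2"
      "2 ^ n * (real_of_int j / 2 ^ n) = of_int j" "2 ^ n * ((real_of_int j + 1) / 2 ^ n) = of_int (j + 1)"
      by (simp_all add: field_simps)
    ultimately show ?thesis using 1 by (simp only: tri_of_int) simp
  next
    \<comment> \<open>All three scaled points are integers, where \<open>tri\<close>
      vanishes.\<close>
    case 2
    then obtain p where p: "k = n + Suc p" using less_imp_Suc_add by auto
    have "2 ^ k * ((2 * real_of_int j + 1) / 2 ^ Suc n) = of_int ((2 * j + 1) * 2 ^ p)"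
      "2 ^ k * (real_of_int j / 2 ^ n) = of_int (j * 2 ^ Suc p)"
      "2 ^ k * ((real_of_int j + 1) / 2 ^ n) = of_int ((j + 1) * 2 ^ Suc p)"
      by (simp_all add: p power_add)
    then show ?thesis using 2 by (simp only: tri_of_int) simp
  next
    case 3
    then obtain p where p: "n = k + Suc p" using less_imp_Suc_add by auto
    \<comment> \<open>For \<open>k < n\<close> the scaled dyadic interval lies inside the half-unit
      interval number \<open>m\<close>, on which \<open>tri\<close> is affine, so the second
      difference vanishes.\<close>
    define m where "m = j div 2 ^ p"
    have e: "2 ^ k * ((2 * real_of_int j + 1) / 2 ^ Suc n) = (of_int j + 1 / 2) / 2 ^ p / 2"
      "2 ^ k * (real_of_int j / 2 ^ n) = of_int j / 2 ^ p / 2"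
      "2 ^ k * ((real_of_int j + 1) / 2 ^ n) = (of_int j + 1) / 2 ^ p / 2"
      by (simp_all add: p power_add field_simps)
    have jm: "j = m * 2 ^ p + j mod 2 ^ p" "0 \<le> j mod 2 ^ p" "j mod 2 ^ p < 2 ^ p"
      unfolding m_def by (simp_all only: div_mult_mod_eq) simp_all
    have "m * 2 ^ p \<le> j" "j + 1 \<le> (m + 1) * 2 ^ p"
      using jm unfolding distrib_right by linarith+
    then have "real_of_int (m * 2 ^ p) \<le> of_int j" "real_of_int (j + 1) \<le> of_int ((m + 1) * 2 ^ p)"
      by (simp_all only: of_int_le_iff)
    then have b: "of_int m * 2 ^ p \<le> real_of_int j" "real_of_int j + 1 \<le> (of_int m + 1) * 2 ^ p"
      by simp_all
    define h where "h y = (if even m then y / 2 ^ p / 2 - of_int m / 2 else (of_int m + 1) / 2 - y / 2 ^ p / 2)"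
      for y :: real
    have t: "tri (y / 2 ^ p / 2) = h y"
      if "of_int j \<le> y" "y \<le> of_int j + 1" for y
      unfolding h_def by (rule tri_affine) (use that b in \<open>simp_all add: field_simps\<close>)
    have "tri ((of_int j + 1 / 2) / 2 ^ p / 2) = h (of_int j + 1 / 2)"
      "tri (of_int j / 2 ^ p / 2) = h (of_int j)" "tri ((of_int j + 1) / 2 ^ p / 2) = h (of_int j + 1)"
      by (rule t; simp)+
    moreover have "h (of_int j + 1 / 2) - (h (of_int j) + h (of_int j + 1)) / 2 = 0"
      by (simp add: h_def field_simps)
    ultimately show ?thesis unfolding e using 3 by simp
  qed
qed

text \<open>The decay rate \<gamma> gives increments of order
  \<open>2 powr (- (real n * \<gamma>))\<close> at scale \<open>1 / 2 ^ n\<close>, up to polynomial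
  factors. The denominator makes the series converge even for \<gamma> = 0; being polynomial, it
  leaves the dimension alone.\<close>

definition takagi_coeff :: "real \<Rightarrow> nat \<Rightarrow> real"
  where "takagi_coeff \<gamma> k = 2 powr (- (real k * \<gamma>)) / (real k + 1)\<^sup>2"

definition takagi :: "real \<Rightarrow> real \<Rightarrow> real"
  where "takagi \<gamma> x = (\<Sum>k. takagi_coeff \<gamma> k * tri (2 ^ k * x))"

lemma summable_inverse_squares: "summable (\<lambda>k. 1 / (real k + 1)\<^sup>2)"
  using summable_Suc_iff[THEN iffD2, OF inverse_power_summable[of 2, where ?'a = real]]
  by (simp add: inverse_eq_divide add.commute)

lemma takagi_coeff_nonneg: "0 \<le> takagi_coeff \<gamma> k"
  by (simp add: takagi_coeff_def)

lemma takagi_coeff_le: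
  assumes "0 \<le> \<gamma>"
  shows "takagi_coeff \<gamma> k \<le> 1 / (real k + 1)\<^sup>2"
proof -
  have "2 powr (- (real k * \<gamma>)) \<le> 2 powr 0" using assms by (intro powr_mono) auto
  then show ?thesis unfolding takagi_coeff_def by (intro divide_right_mono) auto
qed

lemma takagi_term_le:
  assumes "0 \<le> \<gamma>"
  shows "norm (takagi_coeff \<gamma> k * tri (2 ^ k * x)) \<le> 1 / (real k + 1)\<^sup>2"
proof -
  have "tri (2 ^ k * x) \<le> 1" using tri_le_half[of "2 ^ k * x"] by linarith
  then have "takagi_coeff \<gamma> k * tri (2 ^ k * x) \<le> 1 / (real k + 1)\<^sup>2 * 1"
    by (intro mult_mono takagi_coeff_le assms tri_nonneg) auto
  then show ?thesis by (simp add: takagi_coeff_nonneg tri_nonneg)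
qed

lemma takagi_sums:
  assumes "0 \<le> \<gamma>"
  shows "(\<lambda>k. takagi_coeff \<gamma> k * tri (2 ^ k * x)) sums takagi \<gamma> x"
  unfolding takagi_def
  by (intro summable_sums summable_comparison_test'[OF summable_inverse_squares] takagi_term_le assms)

lemma continuous_on_takagi:
  assumes "0 \<le> \<gamma>"
  shows "continuous_on A (takagi \<gamma>)"
proof (rule uniform_limit_theorem)
  show "uniform_limit A (\<lambda>n x. \<Sum>k<n. takagi_coeff \<gamma> k * tri (2 ^ k * x)) (takagi \<gamma>) sequentially"
    unfolding takagi_def
    by (rule Weierstrass_m_test[OF takagi_term_le[OF assms] summable_inverse_squares])
  have "continuous_on UNIV tri"
    by (rule lipschitz_on_continuous_on[of 1], rule lipschitz_onI) (use tri_lipschitz in \<open>auto simp: dist_real_def\<close>)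
  then have "continuous_on A (\<lambda>x. tri (2 ^ k * x))" for k
    by (rule continuous_on_compose2) (auto intro!: continuous_intros)
  then show "\<forall>\<^sub>F n in sequentially. continuous_on A (\<lambda>x. \<Sum>k<n. takagi_coeff \<gamma> k * tri (2 ^ k * x))"
    by (intro always_eventually allI continuous_intros)
qed simp

lemma takagi_second_difference:
  assumes "0 \<le> \<gamma>"
  shows "takagi \<gamma> ((2 * of_int j + 1) / 2 ^ Suc n) -
      (takagi \<gamma> (of_int j / 2 ^ n) + takagi \<gamma> ((of_int j + 1) / 2 ^ n)) / 2 = takagi_coeff \<gamma> n / 2"
proof -
  let ?t = "\<lambda>x k. takagi_coeff \<gamma> k * tri (2 ^ k * x)"
  let ?m = "(2 * of_int j + 1) / 2 ^ Suc n :: real" and ?l = "of_int j / 2 ^ n :: real" and ?r = "(of_int j + 1) / 2 ^ n :: real"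
  have "(\<lambda>k. ?t ?m k - (?t ?l k + ?t ?r k) / 2) sums (takagi \<gamma> ?m - (takagi \<gamma> ?l + takagi \<gamma> ?r) / 2)"
    by (intro sums_diff sums_divide sums_add takagi_sums assms)
  moreover have "?t ?m k - (?t ?l k + ?t ?r k) / 2 = (if k = n then takagi_coeff \<gamma> n / 2 else 0)" for k
  proof -
    have "?t ?m k - (?t ?l k + ?t ?r k) / 2 = takagi_coeff \<gamma> k * (tri (2 ^ k * ?m) - (tri (2 ^ k * ?l) + tri (2 ^ k * ?r)) / 2)"
      by (simp only: right_diff_distrib distrib_left times_divide_eq_right)
    then show ?thesis unfolding tri_second_difference by simp
  qed
  moreover have "(\<lambda>k. if k = n then takagi_coeff \<gamma> n / 2 else 0) sums (takagi_coeff \<gamma> n / 2)"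
    using sums_single[of n "\<lambda>_. takagi_coeff \<gamma> n / 2"] by simp
  ultimately show ?thesis by (simp only: sums_unique2)
qed

text \<open>A term with \<open>k < n\<close> is controlled by the Lipschitz constant
  \<open>2 ^ k\<close> and is at most \<open>2 powr (- (real n * \<gamma>))\<close> because \<gamma>
  \<le> 1. In the other terms \<open>tri\<close> varies by at most 1 and the inverse squares are
  summed. The loss is only linear in \<open>n\<close>.\<close>

lemma takagi_increment_le:
  assumes \<gamma>: "0 \<le> \<gamma>" "\<gamma> \<le> 1" and xy: "\<bar>x - y\<bar> \<le> 1 / 2 ^ n"
  shows "\<bar>takagi \<gamma> x - takagi \<gamma> y\<bar> \<le> 2 powr (- (real n * \<gamma>)) * (real n + (\<Sum>k. 1 / (real k + 1)\<^sup>2))"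
proof -
  let ?h = "\<lambda>k. takagi_coeff \<gamma> k * tri (2 ^ k * x) - takagi_coeff \<gamma> k * tri (2 ^ k * y)"
  let ?b = "\<lambda>k. 2 powr (- (real n * \<gamma>)) * ((if k < n then 1 else 0) + 1 / (real k + 1)\<^sup>2)"
  have b: "(\<lambda>k. if k < n then 1 else 0 :: real) sums (\<Sum>k<n. 1)"
    using sums_If_finite_set[of "{..<n}" "\<lambda>_. 1::real"] by simp
  have bs: "?b sums (2 powr (- (real n * \<gamma>)) * (real n + (\<Sum>k. 1 / (real k + 1)\<^sup>2)))"
    using sums_mult[OF sums_add[OF b summable_sums[OF summable_inverse_squares]], of "2 powr (- (real n * \<gamma>))"] by simp
  have le: "norm (?h k) \<le> ?b k" for k
  proof -
    have n: "norm (?h k) = takagi_coeff \<gamma> k * \<bar>tri (2 ^ k * x) - tri (2 ^ k * y)\<bar>"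
      by (simp add: right_diff_distrib[symmetric] abs_mult takagi_coeff_nonneg)
    show ?thesis
    proof (cases "k < n")
      case True
      have "\<bar>tri (2 ^ k * x) - tri (2 ^ k * y)\<bar> \<le> \<bar>2 ^ k * x - 2 ^ k * y\<bar>" by (rule tri_lipschitz)
      also have "\<dots> = 2 ^ k * \<bar>x - y\<bar>" by (simp add: right_diff_distrib[symmetric] abs_mult)
      also have "\<dots> \<le> 2 ^ k * (1 / 2 ^ n)" using xy by (intro mult_left_mono) auto
      also have "\<dots> = 2 powr (real k - real n)" by (simp add: powr_diff powr_realpow)
      finally have "norm (?h k) \<le> takagi_coeff \<gamma> k * 2 powr (real k - real n)"
        unfolding n by (intro mult_left_mono takagi_coeff_nonneg)
      also have "takagi_coeff \<gamma> k \<le> 2 powr (- (real k * \<gamma>))"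
        unfolding takagi_coeff_def by (simp add: divide_le_eq mult_le_cancel_left1)
      then have "takagi_coeff \<gamma> k * 2 powr (real k - real n) \<le> 2 powr (- (real k * \<gamma>)) * 2 powr (real k - real n)"
        by (intro mult_right_mono) auto
      also have "\<dots> = 2 powr ((real k - real n) * (1 - \<gamma>) - real n * \<gamma>)"
        by (simp add: powr_add[symmetric] algebra_simps)
      also have "\<dots> \<le> 2 powr (- (real n * \<gamma>))"
        using True \<gamma> by (intro powr_mono) (auto simp: mult_le_0_iff)
      also have "\<dots> \<le> ?b k" using True by (simp add: algebra_simps)
      finally show ?thesis .
    next
      case False
      have "norm (?h k) \<le> takagi_coeff \<gamma> k * 1"
        unfolding n by (intro mult_left_mono takagi_coeff_nonneg tri_diff_le_1)
      also have "\<dots> \<le> 2 powr (- (real n * \<gamma>)) / (real k + 1)\<^sup>2"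
        unfolding takagi_coeff_def mult_1_right using False \<gamma>
        by (intro divide_right_mono powr_mono) (auto intro: mult_right_mono)
      finally show ?thesis using False by simp
    qed
  qed
  have "?h sums (takagi \<gamma> x - takagi \<gamma> y)" by (intro sums_diff takagi_sums \<gamma>)
  then have "norm (takagi \<gamma> x - takagi \<gamma> y) \<le> 2 powr (- (real n * \<gamma>)) * (real n + (\<Sum>k. 1 / (real k + 1)\<^sup>2))"
    using suminf_le[OF le] bs le
    by (metis (no_types, lifting) sums_iff summable_comparison_test' norm_suminf_le)
  then show ?thesis by simp
qed

text \<open>The direction \<open>b\<close> is a parameter so that one definition covers the probe on
  the square, \<open>b = (1, 0)\<close>, and its profile on the interval,
  \<open>b = 1\<close>.\<close>

definition probe :: "real \<Rightarrow> 'a \<Rightarrow> 'a::euclidean_space \<Rightarrow> real"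
  where "probe \<gamma> b x = (if x \<in> unit_cube then takagi \<gamma> (x \<bullet> b) else 0)"

lemma probe_cont_fun: "0 \<le> \<gamma> \<Longrightarrow> probe \<gamma> b \<in> cont_fun"
proof -
  assume "0 \<le> \<gamma>"
  then have "continuous_on unit_cube (\<lambda>x. takagi \<gamma> (x \<bullet> b))"
    by (intro continuous_on_compose2[OF continuous_on_takagi[of _ UNIV]]) (auto intro!: continuous_intros)
  then have "continuous_on unit_cube (probe \<gamma> b)"
    by (rule continuous_on_cong[OF refl, THEN iffD1, rotated]) (simp add: probe_def)
  then show ?thesis by (simp add: cont_fun_def probe_def)
qed

lemma abs_diff_le_diameter:
  assumes "f \<in> cont_fun" "i \<in> dyadic_index n" "x \<in> dyadic_cube n i" "y \<in> dyadic_cube n i"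
  shows "\<bar>f x - f y\<bar> \<le> diameter (f ` dyadic_cube n i)"
proof -
  obtain m M where "f ` dyadic_cube n i = {m..M}" using image_dyadic_cube[OF assms(1,2)] .
  then have "bounded (f ` dyadic_cube n i)" by simp
  from diameter_bounded_bound[OF this, of "f x" "f y"] assms show ?thesis by (simp add: dist_real_def)
qed

text \<open>The second difference at the midpoint is the mean of two increments inside the cube,
  neither larger than the diameter.\<close>

lemma diameter_probe_ge:
  assumes "0 \<le> \<gamma>" and b: "b \<in> Basis" and i: "i \<in> dyadic_index n"
  shows "takagi_coeff \<gamma> n / 2 \<le> diameter (probe \<gamma> b ` dyadic_cube n i)"
proof -
  \<comment> \<open>\<open>P t\<close> runs from the lower corner along the edge in direction
    \<open>b\<close>; its ends and midpoint project to those of the dyadic interval.\<close>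
  define P where "P t = (\<Sum>b\<in>Basis. (of_int (i b) * (1 / 2 ^ n)) *\<^sub>R b) + t *\<^sub>R b" for t
  have P: "P t \<bullet> b' = of_int (i b') / 2 ^ n + (if b' = b then t else 0)" if "b' \<in> Basis" for t b'
    using that b by (auto simp: P_def inner_add_left inner_Basis)
  have PQ: "P t \<in> dyadic_cube n i" if "0 \<le> t" "t \<le> 1 / 2 ^ n" for t
    unfolding grid_cube_def using that by (simp add: P add_divide_distrib)
  have v: "probe \<gamma> b (P t) = takagi \<gamma> (of_int (i b) / 2 ^ n + t)" if "0 \<le> t" "t \<le> 1 / 2 ^ n" for t
    using PQ[OF that] dyadic_cube_subset[OF i] b by (auto simp: probe_def P)
  define l m r where "l = P 0" and "m = P (1 / 2 ^ Suc n)" and "r = P (1 / 2 ^ n)"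
  have Q: "l \<in> dyadic_cube n i" "m \<in> dyadic_cube n i" "r \<in> dyadic_cube n i"
    unfolding l_def m_def r_def by (intro PQ; simp add: field_simps)+
  have "probe \<gamma> b l = takagi \<gamma> (of_int (i b) / 2 ^ n)"
    "probe \<gamma> b m = takagi \<gamma> ((2 * of_int (i b) + 1) / 2 ^ Suc n)"
    "probe \<gamma> b r = takagi \<gamma> ((of_int (i b) + 1) / 2 ^ n)"
    unfolding l_def m_def r_def by (subst v; simp add: field_simps)+
  then have "probe \<gamma> b m - (probe \<gamma> b l + probe \<gamma> b r) / 2 = takagi_coeff \<gamma> n / 2"
    using takagi_second_difference[OF assms(1), of "i b" n] by simp
  moreover have "\<bar>probe \<gamma> b m - probe \<gamma> b l\<bar> \<le> diameter (probe \<gamma> b ` dyadic_cube n i)"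
    "\<bar>probe \<gamma> b m - probe \<gamma> b r\<bar> \<le> diameter (probe \<gamma> b ` dyadic_cube n i)"
    using Q by (auto intro: abs_diff_le_diameter[OF probe_cont_fun[OF assms(1)] i])
  ultimately show ?thesis by argo
qed

lemma diameter_probe_le:
  assumes \<gamma>: "0 \<le> \<gamma>" "\<gamma> \<le> 1" and b: "b \<in> Basis" and i: "i \<in> dyadic_index n"
  shows "diameter (probe \<gamma> b ` dyadic_cube n i) \<le> 2 powr (- (real n * \<gamma>)) * (real n + (\<Sum>k. 1 / (real k + 1)\<^sup>2))"
proof (rule diameter_le)
  show "probe \<gamma> b ` dyadic_cube n i \<noteq> {} \<or> 0 \<le> 2 powr (- (real n * \<gamma>)) * (real n + (\<Sum>k. 1 / (real k + 1)\<^sup>2))"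
    using grid_cube_corner[of "1/2^n" i] by auto
  fix u v assume "u \<in> probe \<gamma> b ` dyadic_cube n i" "v \<in> probe \<gamma> b ` dyadic_cube n i"
  then obtain x y where xy: "x \<in> dyadic_cube n i" "y \<in> dyadic_cube n i" "u = probe \<gamma> b x" "v = probe \<gamma> b y" by auto
  have uv: "u = takagi \<gamma> (x \<bullet> b)" "v = takagi \<gamma> (y \<bullet> b)"
    using xy dyadic_cube_subset[OF i] by (auto simp: probe_def)
  have "of_int (i b) * (1 / 2 ^ n) \<le> x \<bullet> b" "x \<bullet> b \<le> of_int (i b) * (1 / 2 ^ n) + 1 / 2 ^ n"
    "of_int (i b) * (1 / 2 ^ n) \<le> y \<bullet> b" "y \<bullet> b \<le> of_int (i b) * (1 / 2 ^ n) + 1 / 2 ^ n"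
    using xy(1,2) b unfolding grid_cube_def by (auto simp: add_divide_distrib)
  then have "\<bar>x \<bullet> b - y \<bullet> b\<bar> \<le> 1 / 2 ^ n" by linarith
  from takagi_increment_le[OF \<gamma> this] show "norm (u - v) \<le> 2 powr (- (real n * \<gamma>)) * (real n + (\<Sum>k. 1 / (real k + 1)\<^sup>2))"
    by (simp add: uv)
qed

section \<open>Box dimension of the graph of the probe\<close>

lemma total_osc_le:
  fixes f g :: "'a::euclidean_space \<Rightarrow> real"
  assumes "\<And>i. i \<in> dyadic_index n \<Longrightarrow> diameter (f ` dyadic_cube n i) \<le> d"
  shows "total_osc n f \<le> 2 ^ (n * DIM('a)) * d"
  unfolding total_osc_def
  using sum_bounded_above[of "dyadic_index n" "\<lambda>i. diameter (f ` dyadic_cube n i)" d, OF assms]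
  by (simp add: card_dyadic_index)

text \<open>\<open>n * d\<close> counts the cubes, the next \<open>n\<close> converts heights into
  numbers of cubes, and \<gamma> is the decay of the oscillation: the origin of the dimension
  \<open>d + 1 - \<gamma>\<close>.\<close>

lemma dyadic_powr:
  "2 ^ (n * d) * (2 ^ n * 2 powr (- (real n * \<gamma>))) = 2 powr (real n * (real d + 1 - \<gamma>))"
proof -
  have "2 ^ (n * d) = 2 powr (real n * real d)" "2 ^ n = 2 powr (real n)"
    by (simp_all add: powr_realpow[symmetric])
  then show ?thesis by (simp add: powr_add[symmetric] algebra_simps)
qed

lemma probe_lower:
  fixes b :: "'a::euclidean_space"
  assumes \<gamma>: "0 \<le> \<gamma>" and b: "b \<in> Basis" and t: "t < real DIM('a) + 1 - \<gamma>"
  shows "\<forall>\<^sub>F n in sequentially. 2 powr (real n * t) \<le> dyadic_count n (probe \<gamma> b)"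
  using eventually_powr_dominates[OF t, of 2]
proof eventually_elim
  case (elim n)
  have "2 ^ (n * DIM('a)) * (takagi_coeff \<gamma> n / 2) \<le> total_osc n (probe \<gamma> b)"
    unfolding total_osc_def
    using sum_bounded_below[of "dyadic_index n" "takagi_coeff \<gamma> n / 2" "\<lambda>i. diameter (probe \<gamma> b ` dyadic_cube n i)",
        OF diameter_probe_ge[OF \<gamma> b]]
    by (simp add: card_dyadic_index)
  then have "2 ^ n * (2 ^ (n * DIM('a)) * (takagi_coeff \<gamma> n / 2)) \<le> dyadic_count n (probe \<gamma> b)"
    unfolding dyadic_count_def by (intro add_increasing mult_left_mono) auto
  also have "2 ^ n * (2 ^ (n * DIM('a)) * (takagi_coeff \<gamma> n / 2)) =
      2 powr (real n * (real DIM('a) + 1 - \<gamma>)) / (2 * (real n + 1)\<^sup>2)"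
    unfolding dyadic_powr[symmetric] takagi_coeff_def by (simp add: field_simps)
  finally have *: "2 powr (real n * (real DIM('a) + 1 - \<gamma>)) / (2 * (real n + 1)\<^sup>2) \<le> dyadic_count n (probe \<gamma> b)" .
  have "2 powr (real n * t) \<le> 2 powr (real n * (real DIM('a) + 1 - \<gamma>)) / (2 * (real n + 1)\<^sup>2)"
    using elim by (subst pos_le_divide_eq) (auto simp: mult.commute)
  with * show ?case by linarith
qed

lemma probe_upper:
  fixes b :: "'a::euclidean_space"
  assumes \<gamma>: "0 \<le> \<gamma>" "\<gamma> \<le> 1" and b: "b \<in> Basis" and t: "real DIM('a) + 1 - \<gamma> < t"
  shows "\<forall>\<^sub>F n in sequentially. dyadic_count n (probe \<gamma> b) \<le> 2 powr (real n * t)"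
  using eventually_powr_dominates[OF t, of "1 + (\<Sum>k. 1 / (real k + 1)\<^sup>2)"]
proof eventually_elim
  case (elim n)
  define S where "S = (\<Sum>k. 1 / (real k + 1)\<^sup>2)"
  define E where "E = 2 powr (real n * (real DIM('a) + 1 - \<gamma>))"
  have S: "0 \<le> S" unfolding S_def by (intro suminf_nonneg summable_inverse_squares) simp
  have "total_osc n (probe \<gamma> b) \<le> 2 ^ (n * DIM('a)) * (2 powr (- (real n * \<gamma>)) * (real n + S))"
    unfolding S_def by (intro total_osc_le diameter_probe_le \<gamma> b)
  then have "2 ^ n * total_osc n (probe \<gamma> b) \<le> 2 ^ n * (2 ^ (n * DIM('a)) * (2 powr (- (real n * \<gamma>)) * (real n + S)))"
    by simp
  also have "\<dots> = E * (real n + S)"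
    unfolding E_def dyadic_powr[symmetric] by simp
  finally have 1: "2 ^ n * total_osc n (probe \<gamma> b) \<le> E * (real n + S)" .
  have "2 ^ (n * DIM('a)) = 2 powr (real n * real DIM('a))" by (simp add: powr_realpow[symmetric])
  \<comment> \<open>Here \<gamma> \<le> 1 enters: the number of columns is dominated by the
    oscillation scale \<open>E\<close>.\<close>
  also have "\<dots> \<le> E" unfolding E_def using \<gamma> by (intro powr_mono mult_left_mono) auto
  finally have "dyadic_count n (probe \<gamma> b) \<le> (1 + real n + S) * E"
    using 1 unfolding dyadic_count_def by (simp add: algebra_simps)
  also have "1 + real n + S \<le> (1 + S) * (real n + 1)\<^sup>2"
    using S by (simp add: power2_eq_square algebra_simps)
  then have "(1 + real n + S) * E \<le> (1 + S) * (real n + 1)\<^sup>2 * E"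
    by (intro mult_right_mono) (auto simp: E_def)
  also have "\<dots> \<le> 2 powr (real n * t)" using elim by (simp add: S_def E_def)
  finally show ?case .
qed

section \<open>Lower dimension along a line of functions\<close>

lemma cont_fun_linear:
  "p \<in> cont_fun \<Longrightarrow> g \<in> cont_fun \<Longrightarrow> (\<lambda>x. c * p x + g x) \<in> cont_fun"
  by (auto simp: cont_fun_def intro!: continuous_intros)

lemma diameter_image_le:
  assumes "i \<in> dyadic_index n" "\<And>x y. x \<in> dyadic_cube n i \<Longrightarrow> y \<in> dyadic_cube n i \<Longrightarrow> \<bar>f x - f y\<bar> \<le> d"
  shows "diameter (f ` dyadic_cube n i) \<le> (d::real)"
proof (rule diameter_le)
  show "f ` dyadic_cube n i \<noteq> {} \<or> 0 \<le> d" using grid_cube_corner[of "1/2^n" i] by auto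
qed (use assms(2) in auto)

text \<open>\<open>(c - c') p\<close> is the difference of the two functions and oscillation is
  subadditive, so two distant parameters cannot both give a small oscillation.\<close>

lemma total_osc_separation:
  fixes p g :: "'a::euclidean_space \<Rightarrow> real"
  assumes "p \<in> cont_fun" "g \<in> cont_fun"
  shows "\<bar>c - c'\<bar> * total_osc n p \<le> total_osc n (\<lambda>x. c * p x + g x) + total_osc n (\<lambda>x. c' * p x + g x)"
  unfolding total_osc_def sum.distrib[symmetric] sum_distrib_left
proof (rule sum_mono)
  fix i :: "'a \<Rightarrow> int" assume i: "i \<in> dyadic_index n"
  let ?d = "\<lambda>c. diameter ((\<lambda>x. c * p x + g x) ` dyadic_cube n i)"
  show "\<bar>c - c'\<bar> * diameter (p ` dyadic_cube n i) \<le> ?d c + ?d c'"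
  proof (cases "c = c'")
    case True
    then show ?thesis using diameter_image_nonneg[OF cont_fun_linear[OF assms] i] by simp
  next
    case False
    have "diameter (p ` dyadic_cube n i) \<le> (?d c + ?d c') / \<bar>c - c'\<bar>"
    proof (rule diameter_image_le[OF i])
      fix x y assume xy: "x \<in> dyadic_cube n i" "y \<in> dyadic_cube n i"
      have "\<bar>c - c'\<bar> * \<bar>p x - p y\<bar> = \<bar>((c * p x + g x) - (c * p y + g y)) - ((c' * p x + g x) - (c' * p y + g y))\<bar>"
        by (simp add: abs_mult[symmetric] algebra_simps)
      also have "\<dots> \<le> \<bar>(c * p x + g x) - (c * p y + g y)\<bar> + \<bar>(c' * p x + g x) - (c' * p y + g y)\<bar>"
        by (rule abs_triangle_ineq4)
      also have "\<dots> \<le> ?d c + ?d c'"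
        by (intro add_mono abs_diff_le_diameter[OF cont_fun_linear[OF assms] i xy])
      finally show "\<bar>p x - p y\<bar> \<le> (?d c + ?d c') / \<bar>c - c'\<bar>"
        using False by (subst pos_le_divide_eq) (auto simp: mult.commute)
    qed
    then show ?thesis using False by (subst (asm) pos_le_divide_eq) (auto simp: mult.commute)
  qed
qed

lemma AE_total_osc_ge:
  fixes p g :: "'a::euclidean_space \<Rightarrow> real"
  assumes "p \<in> cont_fun" "g \<in> cont_fun"
  shows "AE c in lborel. \<forall>\<^sub>F n in sequentially. total_osc n p \<le> (real n + 1)\<^sup>2 * total_osc n (\<lambda>x. c * p x + g x)"
proof -
  define B where "B n = {c. (real n + 1)\<^sup>2 * total_osc n (\<lambda>x. c * p x + g x) < total_osc n p}" for n
  \<comment> \<open>Two oscillations below \<open>T / (n + 1)\<^sup>2\<close>, with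
    \<open>T = total_osc n p\<close>, force
    \<open>\<bar>c - c'\<bar> * T \<le> 2 * T / (n + 1)\<^sup>2\<close> by the separation
    estimate.\<close>
  define r where "r n = 2 * (1 / (real n + 1)\<^sup>2)" for n :: nat
  have r: "r n > 0" for n by (simp add: r_def)
  have close: "\<bar>c - c'\<bar> \<le> r n" if "c \<in> B n" "c' \<in> B n" for c c' n
  proof -
    define T where "T = total_osc n p"
    have lt: "(real n + 1)\<^sup>2 * total_osc n (\<lambda>x. c * p x + g x) < T" "(real n + 1)\<^sup>2 * total_osc n (\<lambda>x. c' * p x + g x) < T"
      using that by (auto simp: B_def T_def)
    have "0 \<le> (real n + 1)\<^sup>2 * total_osc n (\<lambda>x. c * p x + g x)"
      by (intro mult_nonneg_nonneg total_osc_nonneg cont_fun_linear assms) simp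
    \<comment> \<open>A nonempty \<open>B n\<close> forces \<open>T > 0\<close>, so that
      \<open>T\<close> can be cancelled.\<close>
    with lt have T: "T > 0" by linarith
    have "(real n + 1)\<^sup>2 * (\<bar>c - c'\<bar> * T) \<le> (real n + 1)\<^sup>2 * (total_osc n (\<lambda>x. c * p x + g x) + total_osc n (\<lambda>x. c' * p x + g x))"
      unfolding T_def by (intro mult_left_mono total_osc_separation assms) simp
    also have "\<dots> \<le> 2 * T" using lt by (simp add: distrib_left)
    finally have "((real n + 1)\<^sup>2 * \<bar>c - c'\<bar>) * T \<le> 2 * T" by (simp add: mult_ac)
    then have "(real n + 1)\<^sup>2 * \<bar>c - c'\<bar> \<le> 2" using T by simp
    then show ?thesis unfolding r_def times_divide_eq_right mult_1_right
      by (subst pos_le_divide_eq) (auto simp: mult.commute)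
  qed
  \<comment> \<open>An interval around an arbitrary element of \<open>B n\<close>; covering by it
    avoids the question whether \<open>B n\<close> is measurable.\<close>
  define A where "A n = (if B n = {} then {} else {(SOME c. c \<in> B n) - r n .. (SOME c. c \<in> B n) + r n})" for n
  have BA: "B n \<subseteq> A n" for n
  proof
    fix c assume c: "c \<in> B n"
    then have "(SOME c. c \<in> B n) \<in> B n" by (rule someI)
    from close[OF c this] c show "c \<in> A n" by (auto simp: A_def abs_le_iff)
  qed
  have m: "measure lborel (A n) \<le> 4 * (1 / (real n + 1)\<^sup>2)" for n
    using r[of n] by (simp add: A_def) (simp add: r_def)
  have "AE c in lborel. \<forall>\<^sub>F n in sequentially. c \<in> space lborel - A n"
  proof (rule borel_cantelli_AE1)
    show "summable (\<lambda>n. measure lborel (A n))"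
      by (rule summable_comparison_test'[OF summable_mult[OF summable_inverse_squares, of 4]])
        (use m in \<open>simp add: measure_nonneg\<close>)
  qed (auto simp: A_def emeasure_lborel_Icc_eq)
  then show ?thesis
  proof (rule AE_mp, intro AE_I2 impI)
    fix c assume "\<forall>\<^sub>F n in sequentially. c \<in> space lborel - A n"
    then show "\<forall>\<^sub>F n in sequentially. total_osc n p \<le> (real n + 1)\<^sup>2 * total_osc n (\<lambda>x. c * p x + g x)"
      by eventually_elim (use BA in \<open>force simp: B_def\<close>)
  qed
qed

text \<open>The almost sure event compares oscillations and is fixed before the exponent
  \<open>t\<close>, so a single null set serves all \<open>t\<close>. The loss
  \<open>(n + 1)\<^sup>2\<close> is absorbed between \<open>t\<close> and \<open>u\<close>.\<close>

lemma AE_le_lower_box_dim: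
  fixes p g :: "'a::euclidean_space \<Rightarrow> real"
  assumes pg: "p \<in> cont_fun" "g \<in> cont_fun" and s: "0 < s"
    and p: "\<And>t. t < s \<Longrightarrow> \<forall>\<^sub>F n in sequentially. 2 powr (real n * t) \<le> dyadic_count n p"
  shows "AE c in lborel. ereal s \<le> lower_box_dim (graph (\<lambda>x. c * p x + g x))"
  using AE_total_osc_ge[OF pg]
proof (rule AE_mp, intro AE_I2 impI)
  fix c assume *: "\<forall>\<^sub>F n in sequentially. total_osc n p \<le> (real n + 1)\<^sup>2 * total_osc n (\<lambda>x. c * p x + g x)"
  show "ereal s \<le> lower_box_dim (graph (\<lambda>x. c * p x + g x))"
    unfolding le_lower_box_dim_graph_iff[OF cont_fun_linear[OF pg] s]
  proof (intro allI impI)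
    fix t assume "t < s"
    then obtain u where u: "t < u" "u < s" using dense by blast
    show "\<forall>\<^sub>F n in sequentially. 2 powr (real n * t) \<le> dyadic_count n (\<lambda>x. c * p x + g x)"
      using * p[OF u(2)] eventually_powr_dominates[OF u(1), of 1]
    proof eventually_elim
      case (elim n)
      define q where "q = (real n + 1)\<^sup>2"
      have q: "1 \<le> q" by (simp add: q_def)
      have "2 ^ n * total_osc n p \<le> 2 ^ n * (q * total_osc n (\<lambda>x. c * p x + g x))"
        using elim by (intro mult_left_mono) (simp_all add: q_def)
      then have "2 ^ n * total_osc n p \<le> q * (2 ^ n * total_osc n (\<lambda>x. c * p x + g x))"
        by (simp only: mult.left_commute)
      moreover have "1 * 2 ^ (n * DIM('a)) \<le> q * 2 ^ (n * DIM('a))" using q by (intro mult_right_mono) auto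
      ultimately have "dyadic_count n p \<le> q * dyadic_count n (\<lambda>x. c * p x + g x)"
        unfolding dyadic_count_def distrib_left by linarith
      with elim have "q * 2 powr (real n * t) \<le> q * dyadic_count n (\<lambda>x. c * p x + g x)"
        unfolding q_def by linarith
      then show ?case using q by (subst (asm) mult_le_cancel_left_pos) auto
    qed
  qed
qed

section \<open>Upper bounds and sup norm perturbations\<close>

lemma upper_box_dim_linear:
  fixes p g :: "'a::euclidean_space \<Rightarrow> real"
  assumes pg: "p \<in> cont_fun" "g \<in> cont_fun" and s: "0 \<le> s"
    and up: "upper_box_dim (graph p) \<le> ereal s" "upper_box_dim (graph g) \<le> ereal s"
  shows "upper_box_dim (graph (\<lambda>x. c * p x + g x)) \<le> ereal s"
  unfolding upper_box_dim_graph_le_iff[OF cont_fun_linear[OF pg] s]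
proof (intro allI impI)
  fix t assume "s < t"
  then obtain u where u: "s < u" "u < t" using dense by blast
  have "\<forall>\<^sub>F n in sequentially. dyadic_count n p \<le> 2 powr (real n * u)" "\<forall>\<^sub>F n in sequentially. dyadic_count n g \<le> 2 powr (real n * u)"
    using up u(1) upper_box_dim_graph_le_iff[OF _ s] pg by blast+
  then show "\<forall>\<^sub>F n in sequentially. dyadic_count n (\<lambda>x. c * p x + g x) \<le> 2 powr (real n * t)"
    using eventually_powr_dominates_const[OF u(2), of "\<bar>c\<bar> + 1"]
  proof eventually_elim
    case (elim n)
    have "total_osc n (\<lambda>x. c * p x + g x) \<le> \<bar>c\<bar> * total_osc n p + total_osc n g"
      unfolding total_osc_def sum.distrib[symmetric] sum_distrib_left
    proof (intro sum_mono diameter_image_le)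
      fix i :: "'a \<Rightarrow> int" and x y assume i: "i \<in> dyadic_index n" and xy: "x \<in> dyadic_cube n i" "y \<in> dyadic_cube n i"
      have "\<bar>c * p x + g x - (c * p y + g y)\<bar> = \<bar>c * (p x - p y) + (g x - g y)\<bar>" by (simp add: algebra_simps)
      also have "\<dots> \<le> \<bar>c\<bar> * \<bar>p x - p y\<bar> + \<bar>g x - g y\<bar>" by (rule order_trans[OF abs_triangle_ineq]) (simp add: abs_mult)
      also have "\<dots> \<le> \<bar>c\<bar> * diameter (p ` dyadic_cube n i) + diameter (g ` dyadic_cube n i)"
        by (intro add_mono mult_left_mono abs_diff_le_diameter pg i xy) auto
      finally show "\<bar>c * p x + g x - (c * p y + g y)\<bar> \<le> \<bar>c\<bar> * diameter (p ` dyadic_cube n i) + diameter (g ` dyadic_cube n i)" .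
    qed
    then have "2 ^ n * total_osc n (\<lambda>x. c * p x + g x) \<le> 2 ^ n * (\<bar>c\<bar> * total_osc n p + total_osc n g)"
      by simp
    then have "2 ^ n * total_osc n (\<lambda>x. c * p x + g x) \<le> \<bar>c\<bar> * (2 ^ n * total_osc n p) + 2 ^ n * total_osc n g"
      by (simp only: distrib_left mult.left_commute)
    moreover have "0 \<le> \<bar>c\<bar> * 2 ^ (n * DIM('a))" by simp
    ultimately have "dyadic_count n (\<lambda>x. c * p x + g x) \<le> \<bar>c\<bar> * dyadic_count n p + dyadic_count n g"
      unfolding dyadic_count_def distrib_left by linarith
    also have "\<dots> \<le> \<bar>c\<bar> * 2 powr (real n * u) + 2 powr (real n * u)"
      using elim by (intro add_mono mult_left_mono) auto
    also have "\<dots> \<le> 2 powr (real n * t)" using elim by (simp add: algebra_simps)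
    finally show ?case .
  qed
qed

text \<open>Every oscillation is bounded by the diameter of the whole image. The bound 3 on the
  square identifies \<open>C_alpha 3\<close> with \<open>cont_fun\<close>; the bound 2 on the
  interval settles the upper condition on horizons.\<close>

lemma upper_box_dim_graph_le:
  fixes f :: "'a::euclidean_space \<Rightarrow> real"
  assumes f: "f \<in> cont_fun"
  shows "upper_box_dim (graph f) \<le> ereal (real DIM('a) + 1)"
proof (rule upper_box_dim_graph_le_iff[OF f, THEN iffD2], simp, intro allI impI)
  fix t :: real assume t: "real DIM('a) + 1 < t"
  have "compact (f ` unit_cube)" using f by (auto simp: cont_fun_def intro!: compact_continuous_image)
  then have bd: "bounded (f ` unit_cube)" by (rule compact_imp_bounded)
  define d where "d = diameter (f ` unit_cube)"
  have d: "0 \<le> d" using bd by (simp add: d_def diameter_ge_0)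
  show "\<forall>\<^sub>F n in sequentially. dyadic_count n f \<le> 2 powr (real n * t)"
    using eventually_powr_dominates_const[OF t, of "1 + d"]
  proof eventually_elim
    case (elim n)
    define E :: real where "E = 2 powr (real n * (real DIM('a) + 1))"
    have E: "2 ^ (n * DIM('a)) * 2 ^ n = E"
      using dyadic_powr[of n "DIM('a)" 0] by (simp add: E_def)
    have "total_osc n f \<le> 2 ^ (n * DIM('a)) * d"
      unfolding d_def by (intro total_osc_le diameter_subset bd image_mono dyadic_cube_subset)
    then have "2 ^ n * total_osc n f \<le> 2 ^ n * (2 ^ (n * DIM('a)) * d)" by simp
    also have "\<dots> = E * d" unfolding E[symmetric] by simp
    finally have 1: "2 ^ n * total_osc n f \<le> E * d" .
    have "2 ^ (n * DIM('a)) * 1 \<le> 2 ^ (n * DIM('a)) * (2::real) ^ n" by (intro mult_left_mono) auto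
    then have "2 ^ (n * DIM('a)) \<le> E" using E by simp
    with 1 have "dyadic_count n f \<le> (1 + d) * E" by (simp add: dyadic_count_def algebra_simps)
    with elim show ?case by (simp add: E_def)
  qed
qed

lemma total_osc_diff_le:
  fixes f g :: "'a::euclidean_space \<Rightarrow> real"
  assumes fg: "f \<in> cont_fun" "g \<in> cont_fun" and e: "\<And>x. x \<in> unit_cube \<Longrightarrow> \<bar>f x - g x\<bar> \<le> e"
  shows "total_osc n f \<le> total_osc n g + 2 ^ (n * DIM('a)) * (2 * e)"
proof -
  have "total_osc n f \<le> (\<Sum>i\<in>dyadic_index n. diameter (g ` dyadic_cube n i) + 2 * e)"
    unfolding total_osc_def
  proof (intro sum_mono diameter_image_le)
    fix i :: "'a \<Rightarrow> int" and x y assume i: "i \<in> dyadic_index n" and xy: "x \<in> dyadic_cube n i" "y \<in> dyadic_cube n i"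
    have "\<bar>f x - g x\<bar> \<le> e" "\<bar>f y - g y\<bar> \<le> e" using e xy dyadic_cube_subset[OF i] by blast+
    with abs_diff_le_diameter[OF fg(2) i xy] show "\<bar>f x - f y\<bar> \<le> diameter (g ` dyadic_cube n i) + 2 * e" by argo
  qed
  then show ?thesis by (simp add: total_osc_def sum.distrib card_dyadic_index)
qed

text \<open>A perturbation by \<open>e\<close> raises each oscillation by at most
  \<open>2 * e\<close>. The modulus depends on \<open>n\<close>, which suffices because the
  dimension condition is assembled from countably many fixed levels.\<close>

lemma dyadic_count_diff_le:
  fixes f g :: "'a::euclidean_space \<Rightarrow> real"
  assumes fg: "f \<in> cont_fun" "g \<in> cont_fun" and e: "\<And>x. x \<in> unit_cube \<Longrightarrow> \<bar>f x - g x\<bar> \<le> e"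
  shows "dyadic_count n f \<le> dyadic_count n g + 2 ^ n * (2 ^ (n * DIM('a)) * (2 * e))"
proof -
  have "2 ^ n * total_osc n f \<le> 2 ^ n * (total_osc n g + 2 ^ (n * DIM('a)) * (2 * e))"
    by (intro mult_left_mono total_osc_diff_le assms) auto
  then show ?thesis by (simp add: dyadic_count_def distrib_left)
qed

section \<open>The metrics\<close>

lemma le_sup_norm: "x \<in> unit_cube \<Longrightarrow> ennreal \<bar>f x\<bar> \<le> sup_norm f"
  unfolding sup_norm_def by (rule SUP_upper)

lemma sup_norm_leI:
  "(\<And>x. x \<in> unit_cube \<Longrightarrow> \<bar>f x\<bar> \<le> e) \<Longrightarrow> sup_norm f \<le> ennreal e"
  unfolding sup_norm_def by (intro SUP_least ennreal_leI)

lemma sup_norm_commute: "sup_norm (f - g) = sup_norm (g - f)"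
  by (simp add: sup_norm_def abs_minus_commute)

lemma sup_norm_triangle: "sup_norm (f - h) \<le> sup_norm (f - g) + sup_norm (g - h)"
  unfolding sup_norm_def[of "f - h"]
proof (rule SUP_least)
  fix x :: 'a assume x: "x \<in> unit_cube"
  have "ennreal \<bar>(f - h) x\<bar> \<le> ennreal (\<bar>(f - g) x\<bar> + \<bar>(g - h) x\<bar>)"
    by (intro ennreal_leI) simp
  also have "\<dots> = ennreal \<bar>(f - g) x\<bar> + ennreal \<bar>(g - h) x\<bar>" by simp
  also have "\<dots> \<le> sup_norm (f - g) + sup_norm (g - h)" by (intro add_mono le_sup_norm x)
  finally show "ennreal \<bar>(f - h) x\<bar> \<le> sup_norm (f - g) + sup_norm (g - h)" .
qed

lemma cont_fun_eqI:
  assumes "f \<in> cont_fun" "g \<in> cont_fun" "\<And>x. x \<in> unit_cube \<Longrightarrow> f x = g x"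
  shows "f = g"
proof
  fix x show "f x = g x"
    using assms by (cases "x \<in> unit_cube") (auto simp: cont_fun_def)
qed

lemma sup_norm_eq_0_imp:
  assumes "f \<in> cont_fun" "g \<in> cont_fun" "sup_norm (f - g) = 0"
  shows "f = g"
proof (rule cont_fun_eqI[OF assms(1,2)])
  fix x :: 'a assume "x \<in> unit_cube"
  from le_sup_norm[OF this, of "f - g"] assms(3) show "f x = g x" by simp
qed

lemma cont_fun_diff: "f \<in> cont_fun \<Longrightarrow> g \<in> cont_fun \<Longrightarrow> f - g \<in> cont_fun"
  unfolding cont_fun_def by (auto simp: fun_diff_def intro!: continuous_intros)

lemma sup_norm_finite:
  assumes "f \<in> cont_fun"
  shows "sup_norm f < top"
proof -
  have "compact (f ` unit_cube)" using assms by (auto simp: cont_fun_def intro!: compact_continuous_image)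
  then have "bounded (f ` unit_cube)" by (rule compact_imp_bounded)
  then obtain B where "\<forall>y\<in>f ` unit_cube. norm y \<le> B" unfolding bounded_iff by blast
  then have "sup_norm f \<le> ennreal B" by (intro sup_norm_leI) auto
  then show ?thesis by (rule le_less_trans) simp
qed

lemma sup_norm_0: "sup_norm 0 = 0"
  by (simp add: sup_norm_def)

lemma Metric_space_d_inf: "Metric_space cont_fun d_inf"
proof
  fix f g h :: "'a \<Rightarrow> real"
  show "0 \<le> d_inf f g" by (simp add: d_inf_def)
  show "d_inf f g = d_inf g f" by (simp add: d_inf_def sup_norm_commute)
  assume fg: "f \<in> cont_fun" "g \<in> cont_fun"
  show "d_inf f g = 0 \<longleftrightarrow> f = g"
    using sup_norm_eq_0_imp[OF fg] sup_norm_finite[OF cont_fun_diff[OF fg]] sup_norm_0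
    by (auto simp: d_inf_def enn2real_eq_0_iff)
  assume h: "h \<in> cont_fun"
  have "enn2real (sup_norm (f - h)) \<le> enn2real (sup_norm (f - g) + sup_norm (g - h))"
    using sup_norm_finite[OF cont_fun_diff[OF fg]] sup_norm_finite[OF cont_fun_diff[OF fg(2) h]]
    by (intro enn2real_mono sup_norm_triangle) auto
  also have "\<dots> = enn2real (sup_norm (f - g)) + enn2real (sup_norm (g - h))"
    using sup_norm_finite[OF cont_fun_diff[OF fg]] sup_norm_finite[OF cont_fun_diff[OF fg(2) h]]
    by (rule enn2real_plus)
  finally show "d_inf f h \<le> d_inf f g + d_inf g h" by (simp add: d_inf_def)
qed

lemma osc_commute: "osc (f - g) S = osc (g - f) S"
proof -
  have "\<bar>(f - g) x - (f - g) y\<bar> = \<bar>(g - f) x - (g - f) y\<bar>" for x y by simp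
  then show ?thesis unfolding osc_def by simp
qed

lemma osc_triangle: "osc (f - h) S \<le> osc (f - g) S + osc (g - h) S"
  unfolding osc_def[of "f - h"]
proof (intro SUP_least)
  fix x y assume xy: "x \<in> S \<inter> unit_cube" "y \<in> S \<inter> unit_cube"
  have u: "ennreal \<bar>k x - k y\<bar> \<le> osc k S" for k
    unfolding osc_def by (rule SUP_upper2[OF xy(1)], rule SUP_upper[OF xy(2)])
  have "ennreal \<bar>(f - h) x - (f - h) y\<bar> \<le> ennreal (\<bar>(f - g) x - (f - g) y\<bar> + \<bar>(g - h) x - (g - h) y\<bar>)"
    by (intro ennreal_leI) simp
  also have "\<dots> = ennreal \<bar>(f - g) x - (f - g) y\<bar> + ennreal \<bar>(g - h) x - (g - h) y\<bar>" by simp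
  also have "\<dots> \<le> osc (f - g) S + osc (g - h) S" by (intro add_mono u)
  finally show "ennreal \<bar>(f - h) x - (f - h) y\<bar> \<le> osc (f - g) S + osc (g - h) S" .
qed

lemma var_norm_commute: "var_norm \<beta> (f - g) = var_norm \<beta> (g - f)"
  unfolding var_norm_def sup_norm_commute[of f g] osc_commute[of f g] ..

lemma sup_norm_le_var_norm: "sup_norm f \<le> var_norm \<beta> f"
  unfolding var_norm_def by (simp add: add_increasing2)

lemma var_norm_0: "var_norm \<beta> 0 = 0"
proof -
  have "osc 0 S \<le> 0" for S unfolding osc_def by (intro SUP_least) simp
  then show ?thesis by (simp add: var_norm_def sup_norm_0)
qed

lemma var_norm_triangle: "var_norm \<beta> (f - h) \<le> var_norm \<beta> (f - g) + var_norm \<beta> (g - h)"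
proof -
  define V where "V k = (SUP \<delta>\<in>{0<..1}. ennreal (\<delta> powr (\<beta> - 1)) * (\<Sum>S\<in>squares \<delta>. osc k S))" for k
  have "V (f - h) \<le> V (f - g) + V (g - h)"
    unfolding V_def[of "f - h"]
  proof (rule SUP_least)
    fix \<delta> :: real assume \<delta>: "\<delta> \<in> {0<..1}"
    let ?a = "\<lambda>k. ennreal (\<delta> powr (\<beta> - 1)) * (\<Sum>S\<in>squares \<delta>. osc k S)"
    have u: "?a k \<le> V k" for k unfolding V_def by (rule SUP_upper[OF \<delta>])
    have "?a (f - h) \<le> ennreal (\<delta> powr (\<beta> - 1)) * (\<Sum>S\<in>squares \<delta>. osc (f - g) S + osc (g - h) S)"
      by (intro mult_left_mono sum_mono osc_triangle) auto
    also have "\<dots> = ?a (f - g) + ?a (g - h)" by (simp add: sum.distrib distrib_left)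
    also have "\<dots> \<le> V (f - g) + V (g - h)" by (intro add_mono u)
    finally show "?a (f - h) \<le> V (f - g) + V (g - h)" .
  qed
  then have "sup_norm (f - h) + V (f - h) \<le> (sup_norm (f - g) + sup_norm (g - h)) + (V (f - g) + V (g - h))"
    by (intro add_mono sup_norm_triangle)
  moreover have "var_norm \<beta> k = sup_norm k + V k" for k by (simp add: var_norm_def V_def)
  ultimately show ?thesis by (simp add: ac_simps)
qed

text \<open>Truncation at \<open>r\<close> is monotone and subadditive, and it keeps both summands
  finite, so \<open>enn2real\<close> is additive here even where the norms are infinite.\<close>

lemma enn2real_min_triangle:
  fixes a b c :: ennreal
  assumes "c \<le> a + b" "r \<ge> 0"
  shows "enn2real (min (ennreal r) c) \<le> enn2real (min (ennreal r) a) + enn2real (min (ennreal r) b)"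
proof -
  have "min (ennreal r) c \<le> min (ennreal r) a + min (ennreal r) b"
    using assms(1) by (auto simp: min_def intro: order_trans add_increasing add_increasing2)
  then have "enn2real (min (ennreal r) c) \<le> enn2real (min (ennreal r) a + min (ennreal r) b)"
    by (intro enn2real_mono) (auto simp: min_less_iff_disj)
  also have "\<dots> = enn2real (min (ennreal r) a) + enn2real (min (ennreal r) b)"
    by (intro enn2real_plus) (auto simp: min_less_iff_disj)
  finally show ?thesis .
qed

lemma enn2real_min_le: "r \<ge> 0 \<Longrightarrow> enn2real (min (ennreal r) a) \<le> r"
  by (rule enn2real_leI) auto

lemma summable_d_alpha:
  "summable (\<lambda>k. enn2real (min (ennreal (1 / 2 ^ Suc k)) (a k)))"
proof (rule summable_comparison_test')
  show "summable (\<lambda>k. (1 / 2 :: real) ^ Suc k)" by (simp add: summable_geometric)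
  show "norm (enn2real (min (ennreal (1 / 2 ^ Suc k)) (a k))) \<le> (1 / 2 :: real) ^ Suc k" for k
    using enn2real_min_le[of "1 / 2 ^ Suc k" "a k"] by (simp add: power_one_over)
qed

text \<open>The first term of the series alone gives the bound. It is truncated at 1/2, so for
  \<open>e \<le> 1 / 2\<close> a value below \<open>e\<close> cannot be due to the truncation and
  bounds the sup norm.\<close>

lemma d_alpha_less_imp:
  assumes "d_alpha \<alpha> f g < e" "e \<le> 1 / 2" "x \<in> unit_cube"
  shows "\<bar>f x - g x\<bar> < e"
proof -
  let ?t = "\<lambda>k. enn2real (min (ennreal (1 / 2 ^ Suc k)) (var_norm (\<alpha> + 1 / real (Suc k)) (f - g)))"
  have "sum ?t {0} \<le> suminf ?t" by (rule sum_le_suminf[OF summable_d_alpha]) auto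
  then have "sum ?t {0} < e" using assms(1) unfolding d_alpha_def by (rule le_less_trans)
  then have *: "enn2real (min (ennreal (1 / 2)) (var_norm (\<alpha> + 1) (f - g))) < e" by simp
  have "ennreal \<bar>f x - g x\<bar> \<le> var_norm (\<alpha> + 1) (f - g)"
    using le_sup_norm[OF assms(3), of "f - g"] sup_norm_le_var_norm[of "f - g" "\<alpha> + 1"] by simp
  then have "min (ennreal (1 / 2)) (ennreal \<bar>f x - g x\<bar>) \<le> min (ennreal (1 / 2)) (var_norm (\<alpha> + 1) (f - g))"
    by (intro min.mono) auto
  then have "enn2real (min (ennreal (1 / 2)) (ennreal \<bar>f x - g x\<bar>)) < e"
    by (intro le_less_trans[OF enn2real_mono *] le_less_trans[OF min.cobounded1 ennreal_less_top])
  moreover have "min (ennreal (1 / 2)) (ennreal \<bar>f x - g x\<bar>) = ennreal (min (1 / 2) \<bar>f x - g x\<bar>)"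
    by (rule min_of_mono) (simp add: mono_def ennreal_leI)
  ultimately have "min (1 / 2) \<bar>f x - g x\<bar> < e" by (simp only: enn2real_ennreal)
  then show ?thesis using assms(2) by auto
qed

lemma Metric_space_d_alpha:
  assumes "M \<subseteq> cont_fun"
  shows "Metric_space M (d_alpha \<alpha>)"
proof
  fix f g h :: "real \<times> real \<Rightarrow> real"
  show "0 \<le> d_alpha \<alpha> f g" unfolding d_alpha_def by (intro suminf_nonneg summable_d_alpha) simp
  show "d_alpha \<alpha> f g = d_alpha \<alpha> g f" unfolding d_alpha_def var_norm_commute[of _ f g] ..
  have "d_alpha \<alpha> f h \<le> (\<Sum>k. enn2real (min (ennreal (1 / 2 ^ Suc k)) (var_norm (\<alpha> + 1 / real (Suc k)) (f - g))) +
      enn2real (min (ennreal (1 / 2 ^ Suc k)) (var_norm (\<alpha> + 1 / real (Suc k)) (g - h))))"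
    unfolding d_alpha_def
    by (intro suminf_le enn2real_min_triangle var_norm_triangle summable_d_alpha summable_add) simp
  also have "\<dots> = d_alpha \<alpha> f g + d_alpha \<alpha> g h"
    unfolding d_alpha_def by (rule suminf_add[symmetric]; rule summable_d_alpha)
  finally show "d_alpha \<alpha> f h \<le> d_alpha \<alpha> f g + d_alpha \<alpha> g h" .
  assume fg: "f \<in> M" "g \<in> M"
  show "d_alpha \<alpha> f g = 0 \<longleftrightarrow> f = g"
  proof
    assume 0: "d_alpha \<alpha> f g = 0"
    have "f x = g x" if x: "x \<in> unit_cube" for x
    proof (rule ccontr)
      assume "f x \<noteq> g x"
      \<comment> \<open>With this bound \<open>d_alpha_less_imp\<close> makes the distance of the
        two values smaller than itself.\<close>
      then have "d_alpha \<alpha> f g < min (1 / 2) \<bar>f x - g x\<bar>" using 0 by simp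
      from d_alpha_less_imp[OF this min.cobounded1 x] show False by linarith
    qed
    then show "f = g" using fg assms by (intro cont_fun_eqI) auto
  qed (simp add: d_alpha_def var_norm_0)
qed

lemma d_inf_less_imp:
  assumes "f \<in> cont_fun" "g \<in> cont_fun" "d_inf f g < e" "x \<in> unit_cube"
  shows "\<bar>f x - g x\<bar> < e"
proof -
  have "enn2real (ennreal \<bar>f x - g x\<bar>) \<le> d_inf f g"
    unfolding d_inf_def using le_sup_norm[OF assms(4), of "f - g"] sup_norm_finite[OF cont_fun_diff[OF assms(1,2)]]
    by (intro enn2real_mono) auto
  then show ?thesis using assms(3) by simp
qed

section \<open>Horizons and prevalence\<close>

lemma unit_cube_real: "(unit_cube :: real set) = {0..1}"
  by simp

lemma mem_unit_square: "(x, y) \<in> (unit_cube :: (real \<times> real) set) \<longleftrightarrow> x \<in> {0..1} \<and> y \<in> {0..1}"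
  by (auto simp: mem_box ball_Basis_prod)

lemma cont_fun_section:
  fixes f :: "real \<times> real \<Rightarrow> real"
  assumes "f \<in> cont_fun" "x \<in> {0..1}"
  shows "bdd_above ((\<lambda>y. f (x, y)) ` {0..1})"
proof -
  have "continuous_on {0..1} (\<lambda>y. f (x, y))"
    by (rule continuous_on_compose2[of unit_cube f])
      (use assms in \<open>auto simp: cont_fun_def mem_unit_square intro!: continuous_intros\<close>)
  then have "compact ((\<lambda>y. f (x, y)) ` {0..1})" by (intro compact_continuous_image) auto
  then show ?thesis by (intro bounded_imp_bdd_above compact_imp_bounded)
qed

text \<open>The shift \<open>e\<close> may have either sign and the two points may differ, so that
  this covers the dependence on \<open>f\<close>, continuity in \<open>x\<close>, and exact
  translation by a function of \<open>x\<close> alone.\<close>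

lemma horizon_diff_le:
  assumes "f \<in> cont_fun" "g \<in> cont_fun" "x \<in> {0..1}" "x' \<in> {0..1}"
    and "\<And>y. y \<in> {0..1} \<Longrightarrow> f (x, y) \<le> g (x', y) + e"
  shows "horizon f x \<le> horizon g x' + e"
proof -
  have "f (x, y) \<le> (SUP y\<in>{0..1}. g (x', y)) + e" if "y \<in> {0..1}" for y
    using cSUP_upper[OF that cont_fun_section[OF assms(2,4)]] assms(5)[OF that] by linarith
  then have "(SUP y\<in>{0..1}. f (x, y)) \<le> (SUP y\<in>{0..1}. g (x', y)) + e"
    by (intro cSUP_least) auto
  then show ?thesis using assms by (simp add: horizon_def)
qed

lemma horizon_lipschitz:
  assumes fg: "f \<in> cont_fun" "g \<in> cont_fun" and e: "\<And>z. z \<in> unit_cube \<Longrightarrow> \<bar>f z - g z\<bar> \<le> e"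
    and x: "x \<in> unit_cube"
  shows "\<bar>horizon f x - horizon g x\<bar> \<le> e"
proof -
  have x': "x \<in> {0..1}" using x by simp
  have "\<bar>f (x, y) - g (x, y)\<bar> \<le> e" if "y \<in> {0..1}" for y
    using that x' by (intro e) (simp only: mem_unit_square)
  then have "f (x, y) \<le> g (x, y) + e \<and> g (x, y) \<le> f (x, y) + e" if "y \<in> {0..1}" for y
    using that by (smt (verit))
  then have "horizon f x \<le> horizon g x + e" "horizon g x \<le> horizon f x + e"
    using fg x' by (auto intro!: horizon_diff_le)
  then show ?thesis by linarith
qed

text \<open>Uniform continuity makes the sections near \<open>x\<close> close to the one at
  \<open>x\<close>, uniformly in \<open>y\<close>, and suprema inherit this.\<close>

lemma horizon_cont_fun:
  assumes f: "f \<in> cont_fun"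
  shows "horizon f \<in> cont_fun"
proof -
  have "uniformly_continuous_on unit_cube f"
    using f by (intro compact_uniformly_continuous) (auto simp: cont_fun_def)
  have "continuous_on {0..1} (horizon f)"
    unfolding continuous_on_iff
  proof (intro ballI allI impI)
    fix x e :: real assume x: "x \<in> {0..1}" and "0 < e"
    then have "0 < e / 2" by simp
    with \<open>uniformly_continuous_on unit_cube f\<close> obtain d where d: "d > 0"
      "\<And>z z'. z \<in> unit_cube \<Longrightarrow> z' \<in> unit_cube \<Longrightarrow> dist z' z < d \<Longrightarrow> dist (f z') (f z) < e / 2"
      unfolding uniformly_continuous_on_def by metis
    show "\<exists>d>0. \<forall>x'\<in>{0..1}. dist x' x < d \<longrightarrow> dist (horizon f x') (horizon f x) < e"
    proof (intro exI[of _ d] conjI d(1) ballI impI)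
      fix x' :: real assume x': "x' \<in> {0..1}" "dist x' x < d"
      have "dist (f (x', y)) (f (x, y)) < e / 2" if "y \<in> {0..1}" for y
        using that x x' by (intro d(2)) (simp_all only: mem_unit_square dist_Pair_Pair, simp)
      then have "f (x', y) \<le> f (x, y) + e / 2 \<and> f (x, y) \<le> f (x', y) + e / 2" if "y \<in> {0..1}" for y
        using that by (smt (verit) dist_real_def)
      then have "horizon f x' \<le> horizon f x + e / 2" "horizon f x \<le> horizon f x' + e / 2"
        using f x x'(1) by (auto intro!: horizon_diff_le)
      then have "\<bar>horizon f x' - horizon f x\<bar> \<le> e / 2" by linarith
      then show "dist (horizon f x') (horizon f x) < e" using \<open>0 < e\<close> by (simp add: dist_real_def)
    qed
  qed
  then show ?thesis by (simp add: cont_fun_def horizon_def)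
qed

lemma horizon_probe:
  assumes g: "g \<in> cont_fun" and \<gamma>: "0 \<le> \<gamma>"
  shows "horizon (\<lambda>z. c * probe \<gamma> (1, 0) z + g z) = (\<lambda>x. c * probe \<gamma> 1 x + horizon g x)"
proof
  fix x :: real
  show "horizon (\<lambda>z. c * probe \<gamma> (1, 0) z + g z) x = c * probe \<gamma> 1 x + horizon g x"
  proof (cases "x \<in> {0..1}")
    case True
    let ?f = "\<lambda>z. c * probe \<gamma> (1, 0) z + g z"
    have f: "?f \<in> cont_fun" by (intro cont_fun_linear probe_cont_fun g \<gamma>)
    have "probe \<gamma> (1, 0) (x, y) = probe \<gamma> 1 x" if "y \<in> {0..1}" for y :: real
      using that True by (simp add: probe_def mem_unit_square del: mem_box)
    then have eq: "?f (x, y) = g (x, y) + c * probe \<gamma> 1 x" if "y \<in> {0..1}" for y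
      using that by simp
    \<comment> \<open>Shifts by \<open>c * probe \<gamma> 1 x\<close> and by its negative give the
      two halves of the equality.\<close>
    have "horizon ?f x \<le> horizon g x + c * probe \<gamma> 1 x"
      by (rule horizon_diff_le[OF f g True True]) (simp only: eq)
    moreover have "horizon g x \<le> horizon ?f x + (- (c * probe \<gamma> 1 x))"
      by (rule horizon_diff_le[OF g f True True]) (simp only: eq)
    ultimately show ?thesis by simp
  next
    case False
    then have "horizon h x = 0" for h by (simp only: horizon_def if_False)
    moreover have "probe \<gamma> 1 x = 0" using False by (simp only: probe_def unit_cube_real if_False)
    ultimately show ?thesis by simp
  qed
qed

section \<open>Borel measurability of lower dimension conditions\<close>

lemma (in Metric_space) superlevel_borel:
  assumes "\<And>f e. f \<in> M \<Longrightarrow> e > 0 \<Longrightarrow> \<exists>r>0. \<forall>g\<in>M. d f g < r \<longrightarrow> G g < G f + (e::real)"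
  shows "{f \<in> M. a \<le> G f} \<in> sigma_sets M {U. openin mtopology U}"
proof -
  \<comment> \<open>The assumption is upper semicontinuity of \<open>G\<close>, which makes strict
    sublevel sets open.\<close>
  have "openin mtopology {f \<in> M. G f < a}"
    unfolding openin_mtopology
  proof (intro conjI allI impI)
    fix f assume f: "f \<in> {f \<in> M. G f < a}"
    then obtain r where "r > 0" "\<forall>g\<in>M. d f g < r \<longrightarrow> G g < G f + (a - G f)"
      using assms[of f "a - G f"] by auto
    then show "\<exists>r>0. mball f r \<subseteq> {f \<in> M. G f < a}" by (auto simp: subset_iff)
  qed auto
  then have "M - {f \<in> M. G f < a} \<in> sigma_sets M {U. openin mtopology U}"
    by (intro sigma_sets.Compl sigma_sets.Basic) simp
  moreover have "M - {f \<in> M. G f < a} = {f \<in> M. a \<le> G f}" by auto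
  ultimately show ?thesis by simp
qed

text \<open>\<open>T\<close> is the identity for the surface and \<open>horizon\<close> for its
  horizon. The dimension condition is a countable combination of the closed conditions
  \<open>a \<le> dyadic_count n (T f)\<close>.\<close>

lemma (in Metric_space) lower_box_dim_borel:
  fixes T :: "'a \<Rightarrow> 'b::euclidean_space \<Rightarrow> real"
  assumes T: "\<And>f. f \<in> M \<Longrightarrow> T f \<in> cont_fun"
    and cont: "\<And>f e. f \<in> M \<Longrightarrow> e > 0 \<Longrightarrow> \<exists>r>0. \<forall>g\<in>M. d f g < r \<longrightarrow> (\<forall>x\<in>unit_cube. \<bar>T f x - T g x\<bar> \<le> e)"
    and s: "0 < s"
  shows "{f \<in> M. ereal s \<le> lower_box_dim (graph (T f))} \<in> sigma_sets M {U. openin mtopology U}"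
proof -
  define S where "S = sigma M {U. openin mtopology U}"
  have sub: "{U. openin mtopology U} \<subseteq> Pow M" using openin_subset[of mtopology] by auto
  have S: "space S = M" "sets S = sigma_sets M {U. openin mtopology U}"
    using sub by (simp_all add: S_def)
  have B: "{f \<in> space S. a \<le> dyadic_count n (T f)} \<in> sets S" for a n
    unfolding S
  proof (rule superlevel_borel)
    fix f e assume f: "f \<in> M" and e: "(e::real) > 0"
    \<comment> \<open>Chosen so that the perturbation bound of \<open>dyadic_count_diff_le\<close>
      becomes \<open>e / 2\<close>.\<close>
    define e' where "e' = e / (4 * (2 ^ n * 2 ^ (n * DIM('b))))"
    have "e' > 0" using e by (simp add: e'_def)
    with cont[OF f] obtain r where r: "r > 0" "\<forall>g\<in>M. d f g < r \<longrightarrow> (\<forall>x\<in>unit_cube. \<bar>T f x - T g x\<bar> \<le> e')" by blast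
    show "\<exists>r>0. \<forall>g\<in>M. d f g < r \<longrightarrow> dyadic_count n (T g) < dyadic_count n (T f) + e"
    proof (intro exI[of _ r] conjI r(1) ballI impI)
      fix g assume g: "g \<in> M" "d f g < r"
      then have "\<bar>T g x - T f x\<bar> \<le> e'" if "x \<in> unit_cube" for x
        using r(2) that by (metis abs_minus_commute)
      then have "dyadic_count n (T g) \<le> dyadic_count n (T f) + 2 ^ n * (2 ^ (n * DIM('b)) * (2 * e'))"
        by (intro dyadic_count_diff_le T f g)
      also have "2 ^ n * (2 ^ (n * DIM('b)) * (2 * e')) = e / 2" by (simp add: e'_def field_simps)
      finally show "dyadic_count n (T g) < dyadic_count n (T f) + e" using e by linarith
    qed
  qed
  \<comment> \<open>The condition weakens as the exponent decreases, so the exponents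
    \<open>s - 1 / real (Suc m)\<close> suffice and the quantifier becomes countable.\<close>
  have iff: "ereal s \<le> lower_box_dim (graph (T f)) \<longleftrightarrow>
      (\<forall>m. \<forall>\<^sub>F n in sequentially. 2 powr (real n * (s - 1 / real (Suc m))) \<le> dyadic_count n (T f))" if "f \<in> M" for f
    unfolding le_lower_box_dim_graph_iff[OF T[OF that] s]
  proof safe
    fix m assume "\<forall>t<s. \<forall>\<^sub>F n in sequentially. 2 powr (real n * t) \<le> dyadic_count n (T f)"
    then show "\<forall>\<^sub>F n in sequentially. 2 powr (real n * (s - 1 / real (Suc m))) \<le> dyadic_count n (T f)"
      by (rule allE[of _ "s - 1 / real (Suc m)"]) simp
  next
    fix t assume *: "\<forall>m. \<forall>\<^sub>F n in sequentially. 2 powr (real n * (s - 1 / real (Suc m))) \<le> dyadic_count n (T f)" and "t < s"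
    then obtain m where m: "1 / real (Suc m) < s - t" using nat_approx_posE[of "s - t"] by auto
    show "\<forall>\<^sub>F n in sequentially. 2 powr (real n * t) \<le> dyadic_count n (T f)"
      using *[rule_format, of m]
    proof eventually_elim
      case (elim n)
      have "2 powr (real n * t) \<le> 2 powr (real n * (s - 1 / real (Suc m)))"
        using m by (intro powr_mono mult_left_mono) auto
      with elim show ?case by linarith
    qed
  qed
  have "{f \<in> space S. \<forall>m. \<forall>\<^sub>F n in sequentially. 2 powr (real n * (s - 1 / real (Suc m))) \<le> dyadic_count n (T f)} \<in> sets S"
    by (intro sets.sets_Collect_countable_All sets_Collect_eventually_sequentially B)
  moreover have "{f \<in> M. ereal s \<le> lower_box_dim (graph (T f))} =
      {f \<in> space S. \<forall>m. \<forall>\<^sub>F n in sequentially. 2 powr (real n * (s - 1 / real (Suc m))) \<le> dyadic_count n (T f)}"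
    using iff by (auto simp: S)
  ultimately show ?thesis by (simp add: S)
qed

section \<open>The sets \<open>F_alpha\<close> and their probe\<close>

lemma C_alpha_3: "C_alpha 3 = cont_fun"
  using upper_box_dim_graph_le[where 'a = "real \<times> real"] by (auto simp: C_alpha_def)

lemma C_alpha_linear:
  assumes "p \<in> C_alpha \<alpha>" "g \<in> C_alpha \<alpha>" "0 \<le> \<alpha>"
  shows "(\<lambda>x. c * p x + g x) \<in> C_alpha \<alpha>"
  using assms by (auto simp: C_alpha_def intro: cont_fun_linear upper_box_dim_linear)

lemma probe_mem_C_alpha:
  assumes "2 \<le> \<alpha>" "\<alpha> \<le> 3"
  shows "probe (3 - \<alpha>) (1, 0) \<in> C_alpha \<alpha>"
proof -
  have "(1, 0) \<in> (Basis :: (real \<times> real) set)" by (simp add: Basis_prod_def)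
  then have "\<forall>\<^sub>F n in sequentially. dyadic_count n (probe (3 - \<alpha>) (1 :: real, 0 :: real)) \<le> 2 powr (real n * t)" if "\<alpha> < t" for t
    using assms that by (intro probe_upper) auto
  then show ?thesis
    using assms by (auto simp: C_alpha_def upper_box_dim_graph_le_iff probe_cont_fun)
qed

text \<open>Membership in \<open>C_alpha\<close> contains the upper bound for the surface, and
  horizons always have upper dimension at most 2. Two lower bounds remain, and each is accessible to
  the Borel and the almost sure lemmas.\<close>

lemma F_alpha_eq:
  "F_alpha \<alpha> = {f \<in> C_alpha \<alpha>. ereal \<alpha> \<le> lower_box_dim (graph f)} \<inter>
    {f \<in> C_alpha \<alpha>. ereal (\<alpha> - 1) \<le> lower_box_dim (graph (horizon f))}"
proof -
  have "upper_box_dim (graph (horizon f)) \<le> 2" if "f \<in> C_alpha \<alpha>" for f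
    using upper_box_dim_graph_le[OF horizon_cont_fun, of f] that by (simp add: C_alpha_def)
  moreover have "has_box_dim (graph f) \<alpha> \<longleftrightarrow> ereal \<alpha> \<le> lower_box_dim (graph f)" if "f \<in> C_alpha \<alpha>" for f
    using that lower_le_upper_box_dim[of "graph f"] by (auto simp: has_box_dim_def C_alpha_def)
  ultimately show ?thesis
    unfolding F_alpha_def using lower_le_upper_box_dim by auto
qed

text \<open>Coefficients are functions on \<open>{..<1}\<close>, so a Borel null set
  \<open>N\<close> of reals becomes \<open>{..<1} \<rightarrow>\<^sub>E N\<close>. Completion of the
  measure permits the passage to a subset whose measurability is not examined.\<close>

lemma lebesgue_null_on_line:
  assumes "AE c in lborel. c *\<^sub>R p \<notin> A"
  shows "lebesgue_null_on_span 1 (\<lambda>_. p) A"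
proof -
  interpret product_sigma_finite "\<lambda>_::nat. lborel :: real measure" by standard
  obtain N where N: "{c. \<not> c *\<^sub>R p \<notin> A} \<subseteq> N" "N \<in> null_sets lborel"
    using assms by (auto simp: eventually_ae_filter)
  have NM: "N \<in> sets lborel" "emeasure lborel N = 0" using N(2) by auto
  have "emeasure (\<Pi>\<^sub>M i\<in>{..<1::nat}. lborel :: real measure) ({..<1} \<rightarrow>\<^sub>E N) = 0"
    using NM by (subst emeasure_PiM) auto
  moreover have "({..<1::nat} \<rightarrow>\<^sub>E N) \<in> sets (\<Pi>\<^sub>M i\<in>{..<1}. lborel :: real measure)"
    using NM by (intro sets_PiM_I_finite) auto
  ultimately have "({..<1::nat} \<rightarrow>\<^sub>E N) \<in> null_sets (\<Pi>\<^sub>M i\<in>{..<1}. lborel :: real measure)"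
    by auto
  then show ?thesis
    unfolding lebesgue_null_on_span_def
    by (rule null_sets_completion_subset[rotated, OF null_sets_completionI]) (use N(1) in \<open>auto simp: PiE_iff extensional_def\<close>)
qed

text \<open>Common to both metrics: \<open>fine\<close> says that the topology is at least as fine
  as that of uniform convergence, which is how the metric enters the Borel part.\<close>

lemma prevalent_F_alpha:
  assumes \<alpha>: "2 \<le> \<alpha>" "\<alpha> \<le> 3"
    and M: "Metric_space (C_alpha \<alpha>) d"
    and fine: "\<And>f e. f \<in> C_alpha \<alpha> \<Longrightarrow> e > 0 \<Longrightarrow>
      \<exists>r>0. \<forall>g\<in>C_alpha \<alpha>. d f g < r \<longrightarrow> (\<forall>z\<in>unit_cube. \<bar>f z - g z\<bar> \<le> e)"
  shows "prevalent 1 (Metric_space.mtopology (C_alpha \<alpha>) d) (F_alpha \<alpha>)"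
proof -
  interpret Metric_space "C_alpha \<alpha>" d by (rule M)
  define \<gamma> where "\<gamma> = 3 - \<alpha>"
  have \<gamma>: "0 \<le> \<gamma>" "\<gamma> \<le> 1" using \<alpha> by (auto simp: \<gamma>_def)
  define p :: "real \<times> real \<Rightarrow> real" where "p = probe \<gamma> (1, 0)"
  have sub: "C_alpha \<alpha> \<subseteq> cont_fun" by (auto simp: C_alpha_def)
  have pC: "p \<in> C_alpha \<alpha>" unfolding p_def \<gamma>_def by (rule probe_mem_C_alpha[OF \<alpha>])
  have z: "(\<lambda>_. 0) \<in> C_alpha \<alpha>"
    using C_alpha_linear[OF pC pC, of "-1"] \<alpha> by simp
  have "F_alpha \<alpha> \<in> sigma_sets (C_alpha \<alpha>) {U. openin mtopology U}"
  proof -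
    interpret S: sigma_algebra "C_alpha \<alpha>" "sigma_sets (C_alpha \<alpha>) {U. openin mtopology U}"
      by (rule sigma_algebra_sigma_sets) (use openin_subset[of mtopology] in auto)
    have "{f \<in> C_alpha \<alpha>. ereal (\<alpha> - 1) \<le> lower_box_dim (graph (horizon f))} \<in> sigma_sets (C_alpha \<alpha>) {U. openin mtopology U}"
    proof (rule lower_box_dim_borel)
      fix f e assume f: "f \<in> C_alpha \<alpha>" and "e > (0::real)"
      with fine obtain r where r: "r > 0" "\<And>g. g \<in> C_alpha \<alpha> \<Longrightarrow> d f g < r \<Longrightarrow> (\<forall>z\<in>unit_cube. \<bar>f z - g z\<bar> \<le> e)" by metis
      show "\<exists>r>0. \<forall>g\<in>C_alpha \<alpha>. d f g < r \<longrightarrow> (\<forall>x\<in>unit_cube. \<bar>horizon f x - horizon g x\<bar> \<le> e)"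
        using r f sub by (intro exI[of _ r]) (blast intro: horizon_lipschitz)
    qed (use \<alpha> sub horizon_cont_fun in auto)
    moreover have "{f \<in> C_alpha \<alpha>. ereal \<alpha> \<le> lower_box_dim (graph f)} \<in> sigma_sets (C_alpha \<alpha>) {U. openin mtopology U}"
      using sub \<alpha> by (intro lower_box_dim_borel fine) auto
    ultimately show ?thesis
      unfolding F_alpha_eq by (intro S.Int)
  qed
  moreover have "\<exists>q. inj_on q {..<1::nat} \<and> independent (q ` {..<1}) \<and> span (q ` {..<1}) \<subseteq> C_alpha \<alpha> \<and>
      (\<forall>x\<in>C_alpha \<alpha>. lebesgue_null_on_span 1 q (C_alpha \<alpha> - (\<lambda>f. f + x) ` F_alpha \<alpha>))"
  proof (intro exI[of _ "\<lambda>_. p"] conjI ballI)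
    show "inj_on (\<lambda>_. p) {..<1::nat}" by (auto simp: inj_on_def)
    \<comment> \<open>On the cube of level 0, the whole square, the probe has positive oscillation;
      hence \<open>p \<noteq> 0\<close>.\<close>
    have "takagi_coeff \<gamma> 0 / 2 \<le> diameter (p ` dyadic_cube 0 (\<lambda>b\<in>Basis. 0))"
      unfolding p_def by (rule diameter_probe_ge) (auto simp: \<gamma> Basis_prod_def dyadic_index_def)
    then have "diameter (p ` dyadic_cube 0 (\<lambda>b\<in>Basis. 0)) \<noteq> 0" by (auto simp: takagi_coeff_def)
    moreover have "diameter ((0 :: real \<times> real \<Rightarrow> real) ` A) = 0" for A
      by (cases "A = {}") (auto simp: zero_fun_def image_constant_conv)
    ultimately have "p \<noteq> 0" by metis
    then show "independent ((\<lambda>_. p) ` {..<1::nat})" by (simp add: lessThan_Suc)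
    have "k *\<^sub>R p \<in> C_alpha \<alpha>" for k
    proof -
      have "k *\<^sub>R p = (\<lambda>x. k * p x + 0)" by (simp add: scaleR_fun_def)
      then show ?thesis using C_alpha_linear[OF pC z, of k] \<alpha> by simp
    qed
    then show "span ((\<lambda>_. p) ` {..<1::nat}) \<subseteq> C_alpha \<alpha>"
      by (auto simp: lessThan_Suc span_singleton)
    fix x assume x: "x \<in> C_alpha \<alpha>"
    \<comment> \<open>\<open>c p\<close> lies in the translate of \<open>F_alpha \<alpha>\<close> by
      \<open>x\<close> as soon as \<open>c p - x\<close> lies in \<open>F_alpha \<alpha>\<close>;
      the almost sure bounds are applied to this line of functions.\<close>
    define g where "g = (\<lambda>z. - x z)"
    have gC: "g \<in> C_alpha \<alpha>" using C_alpha_linear[OF x z, of "-1"] \<alpha> by (simp add: g_def)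
    have pg: "p \<in> cont_fun" "g \<in> cont_fun" using pC gC sub by auto
    have "AE c in lborel. ereal \<alpha> \<le> lower_box_dim (graph (\<lambda>z. c * p z + g z))"
      by (rule AE_le_lower_box_dim[OF pg])
        (use \<alpha> \<gamma> in \<open>auto simp: p_def \<gamma>_def Basis_prod_def intro!: probe_lower\<close>)
    \<comment> \<open>A line of functions on the interval through \<open>horizon g\<close>;
      \<open>horizon_probe\<close> identifies it with the horizons of the first line.\<close>
    moreover have "AE c in lborel. ereal (\<alpha> - 1) \<le> lower_box_dim (graph (\<lambda>z. c * probe \<gamma> 1 z + horizon g z))"
      by (rule AE_le_lower_box_dim[OF probe_cont_fun[OF \<gamma>(1)] horizon_cont_fun[OF pg(2)]])
        (use \<alpha> \<gamma> in \<open>auto simp: \<gamma>_def intro!: probe_lower\<close>)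
    ultimately have "AE c in lborel. c *\<^sub>R p \<notin> C_alpha \<alpha> - (\<lambda>f. f + x) ` F_alpha \<alpha>"
    proof eventually_elim
      case (elim c)
      let ?f = "\<lambda>z. c * p z + g z"
      have "?f \<in> C_alpha \<alpha>" using C_alpha_linear[OF pC gC] \<alpha> by simp
      then have "?f \<in> F_alpha \<alpha>"
        using elim horizon_probe[OF pg(2) \<gamma>(1)] by (simp add: F_alpha_eq p_def)
      moreover have "c *\<^sub>R p = ?f + x" by (simp add: g_def scaleR_fun_def fun_eq_iff)
      ultimately show ?case by blast
    qed
    then show "lebesgue_null_on_span 1 (\<lambda>_. p) (C_alpha \<alpha> - (\<lambda>f. f + x) ` F_alpha \<alpha>)"
      by (rule lebesgue_null_on_line)
  qed
  ultimately show ?thesis by (simp add: prevalent_def)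
qed

theorem theorem1p6:
  shows "prevalent 1 (Metric_space.mtopology (cont_fun :: (real \<times> real \<Rightarrow> real) set) d_inf) (F_alpha 3)
    \<and> (\<forall>\<alpha>::real. 2 \<le> \<alpha> \<and> \<alpha> < 3 \<longrightarrow>
          prevalent 1 (Metric_space.mtopology (C_alpha \<alpha>) (d_alpha \<alpha>)) (F_alpha \<alpha>))"
proof (intro conjI allI impI)
  \<comment> \<open>\<open>C_alpha_3\<close> brings the first claim under the common lemma; the
    Takagi decay rate is 0 here.\<close>
  have "prevalent 1 (Metric_space.mtopology (C_alpha 3) d_inf) (F_alpha 3)"
  proof (rule prevalent_F_alpha)
    show "Metric_space (C_alpha 3) d_inf" unfolding C_alpha_3 by (rule Metric_space_d_inf)
    fix f and e :: real assume "f \<in> C_alpha 3" "e > 0"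
    then show "\<exists>r>0. \<forall>g\<in>C_alpha 3. d_inf f g < r \<longrightarrow> (\<forall>z\<in>unit_cube. \<bar>f z - g z\<bar> \<le> e)"
      unfolding C_alpha_3 by (intro exI[of _ e]) (blast intro: less_imp_le d_inf_less_imp)
  qed simp_all
  then show "prevalent 1 (Metric_space.mtopology cont_fun d_inf) (F_alpha 3)" by (simp add: C_alpha_3)
next
  fix \<alpha> :: real assume \<alpha>: "2 \<le> \<alpha> \<and> \<alpha> < 3"
  show "prevalent 1 (Metric_space.mtopology (C_alpha \<alpha>) (d_alpha \<alpha>)) (F_alpha \<alpha>)"
  proof (rule prevalent_F_alpha)
    show "Metric_space (C_alpha \<alpha>) (d_alpha \<alpha>)"
      by (rule Metric_space_d_alpha) (auto simp: C_alpha_def)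
    fix f and e :: real assume "f \<in> C_alpha \<alpha>" "e > 0"
    \<comment> \<open>The cap 1/2 is the truncation level of the first term of
      \<open>d_alpha\<close>.\<close>
    have "\<bar>f z - g z\<bar> \<le> e" if "d_alpha \<alpha> f g < min e (1 / 2)" "z \<in> unit_cube" for g z
      using d_alpha_less_imp[OF that(1) min.cobounded2 that(2)] by linarith
    then show "\<exists>r>0. \<forall>g\<in>C_alpha \<alpha>. d_alpha \<alpha> f g < r \<longrightarrow> (\<forall>z\<in>unit_cube. \<bar>f z - g z\<bar> \<le> e)"
      using \<open>e > 0\<close> by (intro exI[of _ "min e (1 / 2)"]) auto
  qed (use \<alpha> in auto)
qed


end
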